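(* Let $p>0$ be real, let $A,B\in\mathbb{M}_n(\mathbb{C})_+$ be positive semidefinite $n\times n$ complex matrices, and let $\|\cdot\|$ be any unitarily invariant norm on $\mathbb{M}_n(\mathbb{C})$. Then $$\Bigl\|\bigl(A^{p/4}B^{p/2}A^{p/4}\bigr)^{1/p}\Bigr\|\le \|A\|^{1/2}\,\|B\|^{1/2}\le \frac{\|A\|+\|B\|}{2}.$$
   Context: $\mathbb{M}_n(\mathbb{C})$ is the algebra of all $n\times n$ complex matrices and $\mathbb{M}_n(\mathbb{C})_+$ is its cone of positive semidefinite matrices. For $X\in\mathbb{M}_n(\mathbb{C})_+$ and $s>0$, the power $X^s$ is defined by the continuous functional calculus applied to $t\mapsto t^s$ on $[0,\infty)$. A norm $\|\cdot\|$ on $\mathbb{M}_n(\mathbb{C})$ is called unitarily invariant if $\|UXV\|=\|X\|$ for all $X\in\mathbb{M}_n(\mathbb{C})$ and all unitary matrices $U,V\in\mathbb{M}_n(\mathbb{C})$. *)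

theory Defs
  imports Complex_Main "Jordan_Normal_Form.Schur_Decomposition"
begin

definition unitary_mat :: "nat \<Rightarrow> complex mat \<Rightarrow> bool" where
  "unitary_mat n U \<longleftrightarrow> U \<in> carrier_mat n n \<and>
     U * mat_adjoint U = 1\<^sub>m n \<and> mat_adjoint U * U = 1\<^sub>m n"

(* The inequality is the order of HOL-Library.Complex_Order: the value of the
   quadratic form is real and nonnegative. *)
definition psd_mat :: "nat \<Rightarrow> complex mat \<Rightarrow> bool" where
  "psd_mat n X \<longleftrightarrow> X \<in> carrier_mat n n \<and> mat_adjoint X = X \<and>
     (\<forall>v \<in> carrier_vec n. 0 \<le> (X *\<^sub>v v) \<bullet>c v)"

(* Values of N outside carrier_mat n n are irrelevant. *)
definition matrix_norm :: "nat \<Rightarrow> (complex mat \<Rightarrow> real) \<Rightarrow> bool" where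
  "matrix_norm n N \<longleftrightarrow>
     (\<forall>X \<in> carrier_mat n n. 0 \<le> N X) \<and>
     (\<forall>X \<in> carrier_mat n n. N X = 0 \<longleftrightarrow> X = 0\<^sub>m n n) \<and>
     (\<forall>c. \<forall>X \<in> carrier_mat n n. N (c \<cdot>\<^sub>m X) = cmod c * N X) \<and>
     (\<forall>X \<in> carrier_mat n n. \<forall>Y \<in> carrier_mat n n. N (X + Y) \<le> N X + N Y)"

definition unitarily_invariant_norm :: "nat \<Rightarrow> (complex mat \<Rightarrow> real) \<Rightarrow> bool" where
  "unitarily_invariant_norm n N \<longleftrightarrow> matrix_norm n N \<and>
     (\<forall>X \<in> carrier_mat n n. \<forall>U V. unitary_mat n U \<longrightarrow> unitary_mat n V \<longrightarrow>
        N (U * X * V) = N X)"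

definition real_diag :: "nat \<Rightarrow> (nat \<Rightarrow> real) \<Rightarrow> complex mat" where
  "real_diag n d = mat_diag n (\<lambda>i. complex_of_real (d i))"

(* f(X) = U diag(f(d)) U* whenever X = U diag(d) U* with U unitary and d real.
   By fun_calc_eq below the result does not depend on the diagonalization; one
   exists for every Hermitian X by the spectral theorem. *)
definition fun_calc :: "(real \<Rightarrow> real) \<Rightarrow> complex mat \<Rightarrow> complex mat" where
  "fun_calc f X = (THE Y. \<exists>U d. unitary_mat (dim_row X) U \<and>
     X = U * real_diag (dim_row X) d * mat_adjoint U \<and>
     Y = U * real_diag (dim_row X) (\<lambda>i. f (d i)) * mat_adjoint U)"

definition mat_powr :: "complex mat \<Rightarrow> real \<Rightarrow> complex mat" where
  "mat_powr X s = fun_calc (\<lambda>t. t powr s) X"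

lemma real_diag_carrier [simp]: "real_diag n d \<in> carrier_mat n n"
  by (simp add: real_diag_def)

lemma mat_adjoint_carrier: "A \<in> carrier_mat n m \<Longrightarrow> mat_adjoint A \<in> carrier_mat m n"
  by (auto simp: mat_adjoint_def mat_of_rows_def)

lemma fun_calc_unique:
  assumes U: "unitary_mat n U" and V: "unitary_mat n V"
    and eq: "U * real_diag n d * mat_adjoint U = V * real_diag n e * mat_adjoint V"
  shows "U * real_diag n (\<lambda>i. f (d i)) * mat_adjoint U =
         V * real_diag n (\<lambda>i. f (e i)) * mat_adjoint V"
proof -
  define U' V' where "U' = mat_adjoint U" and "V' = mat_adjoint V"
  have Uc: "U \<in> carrier_mat n n" "U' \<in> carrier_mat n n" "U * U' = 1\<^sub>m n" "U' * U = 1\<^sub>m n"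
    using U by (auto simp: unitary_mat_def U'_def mat_adjoint_carrier)
  have Vc: "V \<in> carrier_mat n n" "V' \<in> carrier_mat n n" "V * V' = 1\<^sub>m n" "V' * V = 1\<^sub>m n"
    using V by (auto simp: unitary_mat_def V'_def mat_adjoint_carrier)
  note c = Uc(1,2) Vc(1,2)
  define W where "W = V' * U"
  have Wc: "W \<in> carrier_mat n n" using c by (auto simp: W_def)
  have VW: "V * W = U"
  proof -
    have "V * W = V * V' * U" using c by (simp add: W_def)
    thus ?thesis using c Vc(3) by simp
  qed
  have VU: "W * U' = V'"
  proof -
    have "W * U' = V' * (U * U')" using c by (simp add: W_def)
    thus ?thesis using c Uc(3) by simp
  qed
  have l: "V' * (U * real_diag n a * U') * U = W * real_diag n a" for a
  proof -
    have "V' * (U * real_diag n a * U') * U = V' * (U * (real_diag n a * (U' * U)))"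
      using c by (simp add: assoc_mult_mat[of _ n n _ n _ n] mult_carrier_mat[of _ n n _ n])
    thus ?thesis using c Uc(4)
      by (simp add: W_def right_mult_one_mat[of _ n n] assoc_mult_mat[of _ n n _ n _ n] mult_carrier_mat[of _ n n _ n])
  qed
  have r: "V' * (V * real_diag n a * V') * U = real_diag n a * W" for a
  proof -
    have "V' * (V * real_diag n a * V') * U = (V' * V) * (real_diag n a * (V' * U))"
      using c by (simp add: assoc_mult_mat[of _ n n _ n _ n] mult_carrier_mat[of _ n n _ n])
    thus ?thesis using c Vc(4)
      by (simp add: W_def left_mult_one_mat[of _ n n] mult_carrier_mat[of _ n n _ n])
  qed
  have WD: "W * real_diag n d = real_diag n e * W"
    using l[of d] r[of e] eq by (simp add: U'_def V'_def)
  have "W * real_diag n (\<lambda>i. f (d i)) = real_diag n (\<lambda>i. f (e i)) * W"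
  proof (rule eq_matI)
    fix i j assume "i < dim_row (real_diag n (\<lambda>i. f (e i)) * W)"
      "j < dim_col (real_diag n (\<lambda>i. f (e i)) * W)"
    hence ij: "i < n" "j < n" using Wc real_diag_carrier[of n "\<lambda>i. f (e i)"] by auto
    have entry: "(W * real_diag n a) $$ (i,j) = W $$ (i,j) * a j"
      "(real_diag n a * W) $$ (i,j) = a i * W $$ (i,j)" for a
      using ij Wc by (simp_all add: real_diag_def mat_diag_mult_left[OF Wc] mat_diag_mult_right[OF Wc])
    have "W $$ (i,j) * d j = e i * W $$ (i,j)"
      using WD entry by metis
    hence "W $$ (i,j) = 0 \<or> d j = e i" by (simp add: mult.commute)
    thus "(W * real_diag n (\<lambda>i. f (d i))) $$ (i,j) = (real_diag n (\<lambda>i. f (e i)) * W) $$ (i,j)"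
      using entry[of "\<lambda>i. f (d i)"] entry[of "\<lambda>i. f (e i)"] by auto
  next
    show "dim_row (W * real_diag n (\<lambda>i. f (d i))) = dim_row (real_diag n (\<lambda>i. f (e i)) * W)"
      "dim_col (W * real_diag n (\<lambda>i. f (d i))) = dim_col (real_diag n (\<lambda>i. f (e i)) * W)"
      using Wc by (auto simp: real_diag_def mat_diag_def)
  qed
  hence "V * (W * real_diag n (\<lambda>i. f (d i))) * U' = V * (real_diag n (\<lambda>i. f (e i)) * W) * U'"
    by simp
  moreover have "V * (W * real_diag n (\<lambda>i. f (d i))) * U' = U * real_diag n (\<lambda>i. f (d i)) * U'"
    using c Wc VW assoc_mult_mat[of V n n W n "real_diag n (\<lambda>i. f (d i))" n] by simp
  moreover have "V * (real_diag n (\<lambda>i. f (e i)) * W) * U' = V * real_diag n (\<lambda>i. f (e i)) * (W * U')"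
    using c Wc by (simp add: assoc_mult_mat[of _ n n _ n _ n] mult_carrier_mat[of _ n n _ n])
  ultimately show ?thesis using VU by (simp add: U'_def V'_def)
qed

lemma fun_calc_eq:
  assumes "unitary_mat n U" and X: "X = U * real_diag n d * mat_adjoint U"
  shows "fun_calc f X = U * real_diag n (\<lambda>i. f (d i)) * mat_adjoint U"
proof -
  have "dim_row X = n" using assms by (auto simp: unitary_mat_def)
  thus ?thesis unfolding fun_calc_def
    using assms by (intro the_equality) (auto intro: fun_calc_unique)
qed

end

theory Submission
  imports Defs "Jordan_Normal_Form.Spectral_Radius"
begin

text \<open>
  Write \<open>D = A\<^sup>p\<^sup>/\<^sup>4\<close> and \<open>E = B\<^sup>p\<^sup>/\<^sup>4\<close>. The matrix \<open>D E\<^sup>2 D\<close> whose power is taken is the Gram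
  matrix of \<open>E D\<close>, so its eigenvalues \<open>x\<^sub>0 \<ge> x\<^sub>1 \<ge> \<dots>\<close> are the squared singular values of a product.
  Horn's inequality (\<open>horn_log_majorization\<close>) bounds the products of the largest ones by
  \<open>x\<^sub>0 \<cdots> x\<^sub>k \<le> (d\<^sub>0 e\<^sub>0 \<cdots> d\<^sub>k e\<^sub>k)\<^sup>2\<close>, where \<open>d\<^sub>i = a\<^sub>i\<^sup>p\<^sup>/\<^sup>4\<close> and \<open>e\<^sub>i = b\<^sub>i\<^sup>p\<^sup>/\<^sup>4\<close> come from the ordered
  eigenvalues \<open>a\<close> of \<open>A\<close> and \<open>b\<close> of \<open>B\<close>. Raising this to the power \<open>1/p\<close> removes \<open>p\<close>: the eigenvalues
  of \<open>(D E\<^sup>2 D)\<^sup>1\<^sup>/\<^sup>p\<close> are log-majorized by the numbers \<open>\<surd>a\<^sub>i \<surd>b\<^sub>i\<close>. Log-majorization implies weak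
  majorization, under which every unitarily invariant norm is monotone (\<open>ky_fan_dominance\<close>), so the
  left-hand side is at most the norm of \<open>diag(\<surd>a\<^sub>i \<surd>b\<^sub>i)\<close>. Finally
  \<open>2 \<surd>a\<^sub>i \<surd>b\<^sub>i \<le> t a\<^sub>i + b\<^sub>i / t\<close> for all \<open>t > 0\<close>, and the best \<open>t\<close> turns the triangle
  inequality into \<open>\<parallel>A\<parallel>\<^sup>1\<^sup>/\<^sup>2 \<parallel>B\<parallel>\<^sup>1\<^sup>/\<^sup>2\<close>.

  Horn's inequality is proved without exterior powers. For the full product it is the multiplicativity
  of the determinant. For the first \<open>k + 1\<close> factors, flatten the spectra of \<open>D\<close> and \<open>E\<close> after index \<open>k\<close>
  to the constants \<open>d\<^sub>k\<close> and \<open>e\<^sub>k\<close>. This only enlarges the eigenvalues of the Gram matrix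
  (\<open>gram_eigenvalue_mono\<close>, by the min-max principle), while those after index \<open>k\<close> are at least
  \<open>(d\<^sub>k e\<^sub>k)\<^sup>2\<close> (\<open>gram_eigenvalue_lower\<close>), so these cancel from the determinant identity. A small
  \<open>\<epsilon> > 0\<close> added to both spectra makes the matrices invertible and the cancelled factors positive, and
  then tends to \<open>0\<close>.
\<close>

section \<open>Adjoints, unitary matrices and unitary diagonalizations\<close>

lemma index_mat_adjoint:
  "A \<in> carrier_mat m n \<Longrightarrow> i < n \<Longrightarrow> j < m \<Longrightarrow> mat_adjoint A $$ (i, j) = cnj (A $$ (j, i))"
  by (auto simp: mat_adjoint_def mat_of_rows_index)

lemma mat_adjoint_mult:
  fixes A B :: "complex mat"
  assumes "A \<in> carrier_mat n n" "B \<in> carrier_mat n n"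
  shows "mat_adjoint (A * B) = mat_adjoint B * mat_adjoint A"
proof (rule eq_matI)
  have c: "mat_adjoint A \<in> carrier_mat n n" "mat_adjoint B \<in> carrier_mat n n"
    "mat_adjoint (A * B) \<in> carrier_mat n n"
    using assms by (auto intro!: mat_adjoint_carrier)
  show "dim_row (mat_adjoint (A * B)) = dim_row (mat_adjoint B * mat_adjoint A)"
    "dim_col (mat_adjoint (A * B)) = dim_col (mat_adjoint B * mat_adjoint A)"
    using c by auto
  fix i j assume "i < dim_row (mat_adjoint B * mat_adjoint A)" "j < dim_col (mat_adjoint B * mat_adjoint A)"
  hence ij: "i < n" "j < n" using c by auto
  show "mat_adjoint (A * B) $$ (i, j) = (mat_adjoint B * mat_adjoint A) $$ (i, j)"
    using ij assms c
    by (simp add: index_mat_adjoint[of _ n n] mult_carrier_mat[of _ n n] scalar_prod_def mult.commute)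
qed

lemma mat_adjoint_adjoint [simp]: "mat_adjoint (mat_adjoint (A :: complex mat)) = A"
proof -
  have A: "A \<in> carrier_mat (dim_row A) (dim_col A)" by simp
  from mat_adjoint_carrier[OF mat_adjoint_carrier[OF A]] mat_adjoint_carrier[OF A]
  show ?thesis
    by (intro eq_matI)
       (auto simp: index_mat_adjoint[OF A] index_mat_adjoint[OF mat_adjoint_carrier[OF A]])
qed

lemma index_real_diag [simp]:
  "i < n \<Longrightarrow> j < n \<Longrightarrow> real_diag n d $$ (i, j) = (if i = j then complex_of_real (d i) else 0)"
  by (simp add: real_diag_def mat_diag_def)

lemma dim_real_diag [simp]: "dim_row (real_diag n d) = n" "dim_col (real_diag n d) = n"
  by (simp_all add: real_diag_def mat_diag_def)

lemma mat_adjoint_real_diag [simp]: "mat_adjoint (real_diag n d) = real_diag n d"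
proof -
  have "mat_adjoint (real_diag n d) \<in> carrier_mat n n" by (intro mat_adjoint_carrier) simp
  thus ?thesis by (intro eq_matI) (auto simp: index_mat_adjoint[of _ n n])
qed

lemma real_diag_cong: "(\<And>i. i < n \<Longrightarrow> d i = e i) \<Longrightarrow> real_diag n d = real_diag n e"
  by (intro eq_matI) auto

lemma real_diag_mult: "real_diag n d * real_diag n e = real_diag n (\<lambda>i. d i * e i)"
  by (simp add: real_diag_def mat_diag_diag)

lemma real_diag_one: "real_diag n (\<lambda>_. 1) = 1\<^sub>m n"
  by (intro eq_matI) auto

lemma det_real_diag: "det (real_diag n d) = of_real (\<Prod>i<n. d i)"
  by (subst det_upper_triangular[of _ n])
     (auto simp: diag_mat_def prod.distinct_set_conv_list[symmetric] atLeast0LessThan intro!: prod.cong)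

abbreviation unitary_diag :: "nat \<Rightarrow> complex mat \<Rightarrow> (nat \<Rightarrow> real) \<Rightarrow> complex mat" where
  "unitary_diag n U d \<equiv> U * real_diag n d * mat_adjoint U"

lemma unitary_matI:
  assumes "U \<in> carrier_mat n n" "mat_adjoint U * U = 1\<^sub>m n"
  shows "unitary_mat n U"
  using assms mat_mult_left_right_inverse[OF mat_adjoint_carrier[OF assms(1)] assms(1)]
  by (simp add: unitary_mat_def)

lemma unitary_matD:
  assumes "unitary_mat n U"
  shows "U \<in> carrier_mat n n" "mat_adjoint U \<in> carrier_mat n n"
    "U * mat_adjoint U = 1\<^sub>m n" "mat_adjoint U * U = 1\<^sub>m n"
  using assms by (auto simp: unitary_mat_def mat_adjoint_carrier)

lemma mat_adjoint_one: "mat_adjoint (1\<^sub>m n) = (1\<^sub>m n :: complex mat)"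
  using mat_adjoint_real_diag[of n "\<lambda>_. 1"] by (simp only: real_diag_one)

lemma unitary_mat_one: "unitary_mat n (1\<^sub>m n)"
  by (intro unitary_matI) (simp_all add: mat_adjoint_one)

lemma unitary_mat_adjoint: "unitary_mat n U \<Longrightarrow> unitary_mat n (mat_adjoint U)"
  by (auto simp: unitary_mat_def mat_adjoint_carrier)

lemma unitary_mat_mult:
  assumes U: "unitary_mat n U" and V: "unitary_mat n V"
  shows "unitary_mat n (U * V)"
proof (rule unitary_matI)
  note c = unitary_matD[OF U] unitary_matD[OF V]
  show "U * V \<in> carrier_mat n n" using c by simp
  have "mat_adjoint (U * V) * (U * V) = mat_adjoint V * (mat_adjoint U * U) * V"
    using c(1,2,5,6) by (simp add: mat_adjoint_mult[of _ n] assoc_mult_mat[of _ n n _ n _ n] mult_carrier_mat[of _ n n _ n])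
  thus "mat_adjoint (U * V) * (U * V) = 1\<^sub>m n" using c by simp
qed

text \<open>
  The two forms of a unitary similarity. The right-hand one can be combined with Gram matrices,
  the left-hand one is the form required by the functional calculus.
\<close>
lemma unitary_conj_iff:
  assumes U: "unitary_mat n U" and "X \<in> carrier_mat n n" "Y \<in> carrier_mat n n"
  shows "X = U * Y * mat_adjoint U \<longleftrightarrow> mat_adjoint U * X * U = Y"
proof -
  note c = unitary_matD[OF U] assms(2,3)
  have 1: "mat_adjoint U * (U * Y * mat_adjoint U) * U = (mat_adjoint U * U) * Y * (mat_adjoint U * U)"
    "U * (mat_adjoint U * X * U) * mat_adjoint U = (U * mat_adjoint U) * X * (U * mat_adjoint U)"
    using c(1,2,5,6) by (simp_all add: assoc_mult_mat[of _ n n _ n _ n] mult_carrier_mat[of _ n n _ n])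
  show ?thesis using 1 c by auto
qed

section \<open>Quadratic forms and the min-max principle\<close>

definition sqnorm :: "complex vec \<Rightarrow> real" where
  "sqnorm v = (\<Sum>i<dim_vec v. (cmod (v $ i))\<^sup>2)"

lemma sqnorm_eq_sum: "v \<in> carrier_vec n \<Longrightarrow> sqnorm v = (\<Sum>i<n. (cmod (v $ i))\<^sup>2)"
  by (auto simp: sqnorm_def)

lemma of_real_sqnorm: "complex_of_real (sqnorm v) = v \<bullet>c v"
  by (simp add: sqnorm_def scalar_prod_def atLeast0LessThan complex_norm_square flip: of_real_power del: of_real_power)

lemma mult_mat_vec_cscalar:
  fixes A :: "complex mat"
  assumes "A \<in> carrier_mat n n" "v \<in> carrier_vec n" "w \<in> carrier_vec n"
  shows "(A *\<^sub>v v) \<bullet>c w = v \<bullet>c (mat_adjoint A *\<^sub>v w)"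
proof -
  have c: "mat_adjoint A \<in> carrier_mat n n" using assms by (simp add: mat_adjoint_carrier)
  have "(A *\<^sub>v v) \<bullet>c w = (\<Sum>i<n. \<Sum>j<n. A $$ (i, j) * v $ j * cnj (w $ i))"
    using assms by (simp add: scalar_prod_def atLeast0LessThan sum_distrib_right)
  also have "\<dots> = (\<Sum>j<n. \<Sum>i<n. A $$ (i, j) * v $ j * cnj (w $ i))"
    by (rule sum.swap)
  also have "\<dots> = v \<bullet>c (mat_adjoint A *\<^sub>v w)"
    using assms c
    by (simp add: scalar_prod_def atLeast0LessThan sum_distrib_left index_mat_adjoint[of _ n n] algebra_simps)
  finally show ?thesis .
qed

lemma real_diag_mult_vec:
  assumes z: "z \<in> carrier_vec n"
  shows "real_diag n x *\<^sub>v z = vec n (\<lambda>i. complex_of_real (x i) * z $ i)"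
proof (rule eq_vecI)
  fix i assume "i < dim_vec (vec n (\<lambda>i. complex_of_real (x i) * z $ i))"
  hence i: "i < n" by simp
  have "(real_diag n x *\<^sub>v z) $ i = (\<Sum>j<n. real_diag n x $$ (i, j) * z $ j)"
    using i z by (simp add: scalar_prod_def atLeast0LessThan)
  also have "\<dots> = (\<Sum>j<n. if i = j then complex_of_real (x i) * z $ j else 0)"
    using i by (intro sum.cong) auto
  finally show "(real_diag n x *\<^sub>v z) $ i = vec n (\<lambda>i. complex_of_real (x i) * z $ i) $ i"
    using i by simp
qed simp

text \<open>
  When the Gram matrix of \<open>K\<close> is diagonal, its quadratic form can be read off in coordinates:
  \<open>\<parallel>K z\<parallel>\<^sup>2 = \<langle>z, K\<^sup>* K z\<rangle>\<close>. All norm computations below are instances of this.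
\<close>
lemma sqnorm_gram_diag:
  assumes K: "K \<in> carrier_mat n n" and g: "mat_adjoint K * K = real_diag n x" and z: "z \<in> carrier_vec n"
  shows "sqnorm (K *\<^sub>v z) = (\<Sum>i<n. x i * (cmod (z $ i))\<^sup>2)"
proof -
  have c: "mat_adjoint K \<in> carrier_mat n n" using K by (simp add: mat_adjoint_carrier)
  have "complex_of_real (sqnorm (K *\<^sub>v z)) = z \<bullet>c (mat_adjoint K *\<^sub>v (K *\<^sub>v z))"
    unfolding of_real_sqnorm using K z by (intro mult_mat_vec_cscalar) auto
  also have "mat_adjoint K *\<^sub>v (K *\<^sub>v z) = real_diag n x *\<^sub>v z"
    using K z c by (simp flip: g add: assoc_mult_mat_vec[of _ n n _ n])
  also have "z \<bullet>c \<dots> = complex_of_real (\<Sum>i<n. x i * (cmod (z $ i))\<^sup>2)"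
    using z
    by (simp add: real_diag_mult_vec scalar_prod_def atLeast0LessThan complex_norm_square mult.left_commute
        flip: of_real_power)
  finally show ?thesis by (simp only: of_real_eq_iff)
qed

lemma sqnorm_unitary:
  assumes "unitary_mat n U" "z \<in> carrier_vec n"
  shows "sqnorm (U *\<^sub>v z) = sqnorm z"
  using sqnorm_gram_diag[of U n "\<lambda>_. 1" z] unitary_matD[OF assms(1)] assms(2)
  by (simp add: real_diag_one sqnorm_def)

lemma sqnorm_unitary_diag:
  assumes U: "unitary_mat n U" and z: "z \<in> carrier_vec n"
  shows "sqnorm (unitary_diag n U d *\<^sub>v z) =
    (\<Sum>i<n. (d i)\<^sup>2 * (cmod ((mat_adjoint U *\<^sub>v z) $ i))\<^sup>2)"
proof -
  note c = unitary_matD[OF U]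
  have "sqnorm (unitary_diag n U d *\<^sub>v z)
      = sqnorm (U *\<^sub>v (real_diag n d *\<^sub>v (mat_adjoint U *\<^sub>v z)))"
    using c(1,2) z
    by (simp add: assoc_mult_mat[of _ n n _ n _ n] mult_carrier_mat[of _ n n _ n] assoc_mult_mat_vec[of _ n n _ n])
  also have "\<dots> = sqnorm (real_diag n d *\<^sub>v (mat_adjoint U *\<^sub>v z))"
    using c z by (intro sqnorm_unitary[OF U]) (auto intro!: mult_mat_vec_carrier[of _ n n])
  also have "\<dots> = (\<Sum>i<n. (d i)\<^sup>2 * (cmod ((mat_adjoint U *\<^sub>v z) $ i))\<^sup>2)"
    using c z by (intro sqnorm_gram_diag) (auto simp: real_diag_mult power2_eq_square)
  finally show ?thesis .
qed

lemma sqnorm_unitary_diag_mono: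
  assumes U: "unitary_mat n U" and z: "z \<in> carrier_vec n"
    and de: "\<And>i. i < n \<Longrightarrow> 0 \<le> d i \<and> d i \<le> e i"
  shows "sqnorm (unitary_diag n U d *\<^sub>v z) \<le> sqnorm (unitary_diag n U e *\<^sub>v z)"
  unfolding sqnorm_unitary_diag[OF U z] using de
  by (intro sum_mono mult_right_mono power_mono) auto

lemma sqnorm_unitary_diag_const:
  assumes U: "unitary_mat n U" and z: "z \<in> carrier_vec n"
  shows "sqnorm (unitary_diag n U (\<lambda>_. t) *\<^sub>v z) = t\<^sup>2 * sqnorm z"
proof -
  have "mat_adjoint U *\<^sub>v z \<in> carrier_vec n" using unitary_matD[OF U] z by auto
  hence "(\<Sum>i<n. t\<^sup>2 * (cmod ((mat_adjoint U *\<^sub>v z) $ i))\<^sup>2) = t\<^sup>2 * sqnorm (mat_adjoint U *\<^sub>v z)"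
    by (simp only: sqnorm_eq_sum sum_distrib_left)
  thus ?thesis unfolding sqnorm_unitary_diag[OF U z] using sqnorm_unitary[OF unitary_mat_adjoint[OF U] z] by simp
qed

text \<open>
  The dimension count of the min-max principle: the two families of conditions are \<open>n - 1\<close> homogeneous
  linear equations in \<open>n\<close> unknowns.
\<close>
lemma exists_vec_in_flag:
  fixes G :: "complex mat"
  assumes G: "G \<in> carrier_mat n n" and k: "k < n"
  shows "\<exists>z \<in> carrier_vec n. z \<noteq> 0\<^sub>v n \<and> (\<forall>i<n. k < i \<longrightarrow> z $ i = 0) \<and> (\<forall>i<k. (G *\<^sub>v z) $ i = 0)"
proof -
  \<comment> \<open>The coefficient matrix of the equations; row \<open>k\<close> is padding, which makes it square and singular.\<close>
  define H :: "complex mat" where "H = mat n n (\<lambda>(i, j). if i < k then G $$ (i, j) else if i = k then 0 else if i = j then 1 else 0)"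
  have H: "H \<in> carrier_mat n n" by (simp add: H_def)
  have "H = mat\<^sub>r n n (\<lambda>i. if i = k then 0\<^sub>v n else row H i)"
    using H by (intro eq_matI) (auto simp: H_def)
  moreover have "det \<dots> = 0" using H by (intro det_row_0[OF k]) auto
  ultimately have "det H = 0" by simp
  then obtain z where z: "z \<in> carrier_vec n" "z \<noteq> 0\<^sub>v n" "H *\<^sub>v z = 0\<^sub>v n"
    using det_0_iff_vec_prod_zero_field[OF H] by auto
  have Hz: "(\<Sum>j<n. H $$ (i, j) * z $ j) = 0" if "i < n" for i
  proof -
    have "(H *\<^sub>v z) $ i = (\<Sum>j<n. H $$ (i, j) * z $ j)"
      using that H z(1) by (simp add: scalar_prod_def atLeast0LessThan)
    thus ?thesis using z(3) that by simp
  qed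
  have "z $ i = 0" if "i < n" "k < i" for i
  proof -
    have "(\<Sum>j<n. H $$ (i, j) * z $ j) = (\<Sum>j<n. if i = j then z $ j else 0)"
      using that by (intro sum.cong) (auto simp: H_def)
    thus ?thesis using Hz[of i] that by simp
  qed
  moreover have "(G *\<^sub>v z) $ i = 0" if "i < k" for i
  proof -
    have "(G *\<^sub>v z) $ i = (\<Sum>j<n. H $$ (i, j) * z $ j)"
      using that k G z(1) by (simp add: scalar_prod_def atLeast0LessThan H_def)
    thus ?thesis using Hz[of i] that k by simp
  qed
  ultimately show ?thesis using z by blast
qed

text \<open>
  Weyl monotonicity in the eigenbases of the two forms, extended to forms that are related by a
  contraction \<open>G\<close> (the case \<open>G = 1\<close> is the usual statement). Test the inequality on a vector \<open>z\<close> on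
  which the first form is at least \<open>x\<^sub>k \<parallel>z\<parallel>\<^sup>2\<close> and whose image makes the second at most \<open>y\<^sub>k \<parallel>G z\<parallel>\<^sup>2\<close>.
\<close>
lemma minmax_le:
  fixes x y :: "nat \<Rightarrow> real"
  assumes G: "G \<in> carrier_mat n n" and k: "k < n"
    and x: "\<And>i j. i \<le> j \<Longrightarrow> j < n \<Longrightarrow> x j \<le> x i" and y: "\<And>i j. i \<le> j \<Longrightarrow> j < n \<Longrightarrow> y j \<le> y i"
    and y0: "0 \<le> y k"
    and contr: "\<And>z. z \<in> carrier_vec n \<Longrightarrow> sqnorm (G *\<^sub>v z) \<le> sqnorm z"
    and form: "\<And>z. z \<in> carrier_vec n \<Longrightarrow>
      (\<Sum>i<n. x i * (cmod (z $ i))\<^sup>2) \<le> (\<Sum>i<n. y i * (cmod ((G *\<^sub>v z) $ i))\<^sup>2)"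
  shows "x k \<le> y k"
proof -
  obtain z where z: "z \<in> carrier_vec n" "z \<noteq> 0\<^sub>v n" "\<And>i. i < n \<Longrightarrow> k < i \<Longrightarrow> z $ i = 0"
    "\<And>i. i < k \<Longrightarrow> (G *\<^sub>v z) $ i = 0"
    using exists_vec_in_flag[OF G k] by blast
  have Gz: "G *\<^sub>v z \<in> carrier_vec n" using G z by auto
  have "x k * sqnorm z = (\<Sum>i<n. x k * (cmod (z $ i))\<^sup>2)"
    using z(1) by (simp add: sqnorm_def sum_distrib_left)
  also have "\<dots> \<le> (\<Sum>i<n. x i * (cmod (z $ i))\<^sup>2)"
  proof (rule sum_mono)
    fix i assume "i \<in> {..<n}"
    thus "x k * (cmod (z $ i))\<^sup>2 \<le> x i * (cmod (z $ i))\<^sup>2"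
      using z(3)[of i] x[of i k] k by (cases "k < i") (auto intro: mult_right_mono)
  qed
  also have "\<dots> \<le> (\<Sum>i<n. y i * (cmod ((G *\<^sub>v z) $ i))\<^sup>2)" by (rule form[OF z(1)])
  also have "\<dots> \<le> (\<Sum>i<n. y k * (cmod ((G *\<^sub>v z) $ i))\<^sup>2)"
  proof (rule sum_mono)
    fix i assume "i \<in> {..<n}"
    thus "y i * (cmod ((G *\<^sub>v z) $ i))\<^sup>2 \<le> y k * (cmod ((G *\<^sub>v z) $ i))\<^sup>2"
      using z(4)[of i] y[of k i] by (cases "i < k") (auto intro: mult_right_mono)
  qed
  also have "\<dots> = y k * sqnorm (G *\<^sub>v z)" by (simp only: sqnorm_eq_sum[OF Gz] sum_distrib_left)
  also have "\<dots> \<le> y k * sqnorm z" using contr[OF z(1)] y0 by (rule mult_left_mono)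
  finally have le: "x k * sqnorm z \<le> y k * sqnorm z" .
  obtain i where "i < n" "z $ i \<noteq> 0" using z(1,2) by (metis carrier_vecD eq_vecI index_zero_vec)
  hence "sqnorm z > 0" using z(1) unfolding sqnorm_def by (intro sum_pos2[of _ i]) auto
  thus ?thesis using le by simp
qed

section \<open>The spectral theorem with ordered eigenvalues\<close>

text \<open>
  The columns are those of a Gram-Schmidt basis that starts with \<open>v\<close>. Gram-Schmidt over an abstract
  field yields orthogonal but not normalized vectors, hence the division by \<open>s i\<close>.
\<close>
lemma exists_unitary_first_col:
  fixes v :: "complex vec"
  assumes v: "v \<in> carrier_vec n" "v \<noteq> 0\<^sub>v n"
  shows "\<exists>W c. unitary_mat n W \<and> col W 0 = c \<cdot>\<^sub>v v"
proof -
  interpret cof_vec_space n "TYPE(complex)" .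
  have n: "0 < n" using v by (cases n) auto
  define b where "b = basis_completion v"
  define ws where "ws = gram_schmidt n b"
  have b: "span (set b) = carrier_vec n" "distinct b" "\<not> lin_dep (set b)" "set b \<subseteq> carrier_vec n"
    "hd b = v" "length b = n"
    using basis_completion[OF v, folded b_def] by auto
  then obtain vs where bv: "b = v # vs" using n by (cases b) auto
  have ws: "set ws \<subseteq> carrier_vec n" "corthogonal ws" "length ws = n"
    using gram_schmidt_result[OF b(4,2,3) refl, folded ws_def] b(6) by auto
  have hdws: "hd ws = v" using gram_schmidt_hd[OF v(1), of vs, folded bv] by (simp add: ws_def)
  define s where "s i = sqrt (sqnorm (ws ! i))" for i
  have wsi: "ws ! i \<in> carrier_vec n" if "i < n" for i using ws that by auto
  have s: "s i \<noteq> 0" if "i < n" for i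
    using corthogonalD[OF ws(2), of i i] that ws(3) by (simp add: s_def flip: of_real_sqnorm)
  have s2: "s i * s i = sqnorm (ws ! i)" for i
    by (simp add: s_def sqnorm_def sum_nonneg)
  define W where "W = mat_of_cols n (map (\<lambda>i. complex_of_real (1 / s i) \<cdot>\<^sub>v (ws ! i)) [0..<n])"
  have W: "W \<in> carrier_mat n n" by (auto simp: W_def)
  have colW: "col W i = complex_of_real (1 / s i) \<cdot>\<^sub>v (ws ! i)" if "i < n" for i
    using that wsi[OF that] unfolding W_def by (subst col_mat_of_cols) auto
  have "mat_adjoint W * W = 1\<^sub>m n"
  proof (rule eq_matI)
    have c: "mat_adjoint W \<in> carrier_mat n n" using W by (simp add: mat_adjoint_carrier)
    show "dim_row (mat_adjoint W * W) = dim_row (1\<^sub>m n)" "dim_col (mat_adjoint W * W) = dim_col (1\<^sub>m n)"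
      using c W by auto
    fix i j assume "i < dim_row (1\<^sub>m n)" "j < dim_col (1\<^sub>m n)"
    hence ij: "i < n" "j < n" by auto
    have "(mat_adjoint W * W) $$ (i, j) = col W j \<bullet>c col W i"
      using ij W c by (simp add: scalar_prod_def index_mat_adjoint[of _ n n] mult.commute)
    also have "\<dots> = complex_of_real (1 / s j) * complex_of_real (1 / s i) * (ws ! j \<bullet>c ws ! i)"
      using ij wsi[of i] wsi[of j] by (simp add: colW scalar_prod_def sum_distrib_left algebra_simps)
    also have "\<dots> = (if i = j then 1 else 0)"
    proof (cases "i = j")
      case True
      have "ws ! j \<bullet>c ws ! i = complex_of_real (s i * s i)"
        unfolding s2 of_real_sqnorm True by (rule refl)
      thus ?thesis using s[OF ij(1)] True by (simp del: of_real_mult add: of_real_mult[symmetric])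
    next
      case False
      hence "ws ! j \<bullet>c ws ! i = 0" using corthogonalD[OF ws(2), of j i] ij ws(3) by auto
      thus ?thesis using False by simp
    qed
    finally show "(mat_adjoint W * W) $$ (i, j) = 1\<^sub>m n $$ (i, j)" using ij by simp
  qed
  hence "unitary_mat n W" using W by (intro unitary_matI)
  moreover have "ws ! 0 = v" using hdws ws(3) n by (cases ws) auto
  ultimately show ?thesis using colW[OF n] by (intro exI[of _ W] exI[of _ "complex_of_real (1 / s 0)"]) auto
qed

text \<open>The block diagonal matrix with blocks \<open>c\<close> and \<open>M\<close>, of dimension one more than \<open>M\<close>.\<close>
definition border :: "nat \<Rightarrow> complex \<Rightarrow> complex mat \<Rightarrow> complex mat" where
  "border n c M = mat (Suc n) (Suc n) (\<lambda>(i, j).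
     case (i, j) of (0, 0) \<Rightarrow> c | (Suc i, Suc j) \<Rightarrow> M $$ (i, j) | _ \<Rightarrow> 0)"

lemma border_carrier [simp]: "border n c M \<in> carrier_mat (Suc n) (Suc n)"
  by (simp add: border_def)

lemma dim_border [simp]: "dim_row (border n c M) = Suc n" "dim_col (border n c M) = Suc n"
  by (simp_all add: border_def)

lemma border_mult:
  assumes "M \<in> carrier_mat n n" "L \<in> carrier_mat n n"
  shows "border n c M * border n d L = border n (c * d) (M * L)"
  using assms
  by (intro eq_matI)
     (auto simp: border_def scalar_prod_def sum.atLeast0_lessThan_Suc_shift split: nat.splits
       simp del: sum.op_ivl_Suc)

lemma border_adjoint:
  assumes "M \<in> carrier_mat n n"
  shows "mat_adjoint (border n c M) = border n (cnj c) (mat_adjoint M)"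
proof (rule eq_matI)
  have c: "mat_adjoint (border n c M) \<in> carrier_mat (Suc n) (Suc n)" by (simp add: mat_adjoint_carrier)
  thus "dim_row (mat_adjoint (border n c M)) = dim_row (border n (cnj c) (mat_adjoint M))"
    "dim_col (mat_adjoint (border n c M)) = dim_col (border n (cnj c) (mat_adjoint M))"
    using border_carrier[of n "cnj c" "mat_adjoint M"] by auto
  fix i j assume "i < dim_row (border n (cnj c) (mat_adjoint M))" "j < dim_col (border n (cnj c) (mat_adjoint M))"
  hence ij: "i < Suc n" "j < Suc n" by (auto simp: border_def)
  have "mat_adjoint (border n c M) $$ (i, j) = cnj (border n c M $$ (j, i))"
    using ij by (rule index_mat_adjoint[OF border_carrier])
  thus "mat_adjoint (border n c M) $$ (i, j) = border n (cnj c) (mat_adjoint M) $$ (i, j)"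
    using assms ij by (auto simp: border_def index_mat_adjoint[of M n n] split: nat.splits)
qed

lemma border_one: "border n 1 (1\<^sub>m n) = 1\<^sub>m (Suc n)"
  by (intro eq_matI) (auto simp: border_def split: nat.splits)

lemma border_real_diag: "border n (complex_of_real c) (real_diag n d) = real_diag (Suc n) (case_nat c d)"
  by (intro eq_matI) (auto simp: border_def split: nat.splits)
text \<open>
  Induction on the dimension. Conjugating with a unitary whose first column is an eigenvector gives a
  matrix whose first column vanishes below the diagonal; being Hermitian, it is block diagonal.
\<close>
theorem hermitian_diagonalization:
  "X \<in> carrier_mat n n \<Longrightarrow> mat_adjoint X = X \<Longrightarrow>
    \<exists>U d. unitary_mat n U \<and> X = unitary_diag n U d"
proof (induction n arbitrary: X)
  case 0
  have "X = 1\<^sub>m 0 * real_diag 0 (\<lambda>_. 0) * mat_adjoint (1\<^sub>m 0)"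
  proof -
    have "X = real_diag 0 (\<lambda>_. 0)" using 0(1) by (intro eq_matI) auto
    thus ?thesis by (simp add: mat_adjoint_one left_mult_one_mat[of _ 0 0] right_mult_one_mat[of _ 0 0])
  qed
  thus ?case using unitary_mat_one by blast
next
  case (Suc n X)
  note X = Suc.prems
  obtain \<mu> where "eigenvalue X \<mu>" using spectrum_non_empty[OF X(1)] by (auto simp: spectrum_def)
  then obtain v where v: "v \<in> carrier_vec (Suc n)" "v \<noteq> 0\<^sub>v (Suc n)" "X *\<^sub>v v = \<mu> \<cdot>\<^sub>v v"
    using X(1) by (auto simp: eigenvalue_def eigenvector_def)
  obtain W c where W: "unitary_mat (Suc n) W" "col W 0 = c \<cdot>\<^sub>v v"
    using exists_unitary_first_col[OF v(1,2)] by blast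
  note cW = unitary_matD[OF W(1)]
  define Y where "Y = mat_adjoint W * X * W"
  have Y: "Y \<in> carrier_mat (Suc n) (Suc n)" using cW X by (simp add: Y_def)
  have XWY: "X = W * Y * mat_adjoint W" using unitary_conj_iff[OF W(1) X(1) Y] by (simp add: Y_def)
  have Yadj: "mat_adjoint Y = Y" unfolding Y_def using cW(1,2) X
    by (simp add: mat_adjoint_mult[of _ "Suc n"] assoc_mult_mat[of _ "Suc n" "Suc n" _ "Suc n" _ "Suc n"]
        mult_carrier_mat[of _ "Suc n" "Suc n" _ "Suc n"])
  have col0: "Y $$ (i, 0) = (if i = 0 then \<mu> else 0)" if i: "i < Suc n" for i
  proof -
    have "col Y 0 = col (mat_adjoint W * (X * W)) 0"
      unfolding Y_def using assoc_mult_mat[OF cW(2) X(1) cW(1)] by simp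
    also have "\<dots> = mat_adjoint W *\<^sub>v (X *\<^sub>v col W 0)"
      using col_mult2[OF cW(2) mult_carrier_mat[OF X(1) cW(1)], of 0] col_mult2[OF X(1) cW(1), of 0] by simp
    also have "X *\<^sub>v col W 0 = \<mu> \<cdot>\<^sub>v col W 0"
      unfolding W(2) mult_mat_vec[OF X(1) v(1)] v(3) by (simp add: smult_smult_assoc mult.commute)
    also have "mat_adjoint W *\<^sub>v \<dots> = \<mu> \<cdot>\<^sub>v (mat_adjoint W *\<^sub>v col W 0)"
      by (rule mult_mat_vec[OF cW(2)]) (metis col_dim carrier_matD(1)[OF cW(1)])
    also have "mat_adjoint W *\<^sub>v col W 0 = col (mat_adjoint W * W) 0"
      using col_mult2[OF cW(2,1), of 0] by simp
    finally have "col Y 0 = \<mu> \<cdot>\<^sub>v unit_vec (Suc n) 0" using cW(4) by simp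
    hence "col Y 0 $ i = (\<mu> \<cdot>\<^sub>v unit_vec (Suc n) 0) $ i" by simp
    thus ?thesis using i Y by auto
  qed
  have Ysym: "Y $$ (i, j) = cnj (Y $$ (j, i))" if "i < Suc n" "j < Suc n" for i j
    using index_mat_adjoint[OF Y that] Yadj by simp
  have row0: "Y $$ (0, i) = (if i = 0 then \<mu> else 0)" if i: "i < Suc n" for i
    using Ysym[of 0 i] col0[of i] col0[of 0] i by (cases "i = 0") auto
  have "\<mu> = cnj \<mu>" using Ysym[of 0 0] col0[of 0] by (metis zero_less_Suc)
  hence l: "\<mu> = complex_of_real (Re \<mu>)" by (simp add: complex_eq_iff)
  define Z where "Z = mat n n (\<lambda>(i, j). Y $$ (Suc i, Suc j))"
  have Z: "Z \<in> carrier_mat n n" by (simp add: Z_def)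
  have YZ: "Y = border n \<mu> Z"
    using Y by (intro eq_matI) (auto simp: border_def Z_def col0 row0 split: nat.splits)
  have "mat_adjoint Z = Z"
  proof (rule eq_matI)
    show "dim_row (mat_adjoint Z) = dim_row Z" "dim_col (mat_adjoint Z) = dim_col Z"
      using mat_adjoint_carrier[OF Z] Z by auto
    fix i j assume "i < dim_row Z" "j < dim_col Z"
    hence ij: "i < n" "j < n" by (simp_all add: Z_def)
    thus "mat_adjoint Z $$ (i, j) = Z $$ (i, j)"
      unfolding index_mat_adjoint[OF Z ij] using Ysym[of "Suc i" "Suc j"] by (simp add: Z_def)
  qed
  from Suc.IH[OF Z this] obtain U d where U: "unitary_mat n U" "Z = unitary_diag n U d" by blast
  note cU = unitary_matD[OF U(1)]
  define V where "V = W * border n 1 U"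
  have "unitary_mat (Suc n) (border n 1 U)"
    using cU by (intro unitary_matI) (auto simp: border_adjoint border_mult border_one)
  hence "unitary_mat (Suc n) V" unfolding V_def by (rule unitary_mat_mult[OF W(1)])
  moreover have "X = V * real_diag (Suc n) (case_nat (Re \<mu>) d) * mat_adjoint V"
  proof -
    have "Y = border n 1 U * real_diag (Suc n) (case_nat (Re \<mu>) d) * mat_adjoint (border n 1 U)"
      using cU l by (simp add: YZ U(2) border_adjoint border_mult flip: border_real_diag)
    hence "X = W * (border n 1 U * real_diag (Suc n) (case_nat (Re \<mu>) d) * mat_adjoint (border n 1 U)) * mat_adjoint W"
      using XWY by simp
    thus ?thesis unfolding V_def using cW(1,2)
      by (simp add: mat_adjoint_mult[of _ "Suc n"] assoc_mult_mat[of _ "Suc n" "Suc n" _ "Suc n" _ "Suc n"]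
        mult_carrier_mat[of _ "Suc n" "Suc n" _ "Suc n"] mat_adjoint_carrier)
  qed
  ultimately show ?case by blast
qed

text \<open>
  Permutation matrices serve twice: they order the eigenvalues, and they show that the norm of a
  diagonal matrix is a symmetric function of the entries.
\<close>
definition perm_mat :: "nat \<Rightarrow> (nat \<Rightarrow> nat) \<Rightarrow> complex mat" where
  "perm_mat n f = mat n n (\<lambda>(i, j). if i = f j then 1 else 0)"

lemma perm_mat_carrier [simp]: "perm_mat n f \<in> carrier_mat n n"
  by (simp add: perm_mat_def)

lemma dim_perm_mat [simp]: "dim_row (perm_mat n f) = n" "dim_col (perm_mat n f) = n"
  by (simp_all add: perm_mat_def)

lemma unitary_perm_mat:
  assumes f: "bij_betw f {..<n} {..<n}"
  shows "unitary_mat n (perm_mat n f)"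
    and "perm_mat n f * real_diag n (d \<circ> f) * mat_adjoint (perm_mat n f) = real_diag n d"
proof -
  let ?P = "perm_mat n f"
  have P: "?P \<in> carrier_mat n n" "mat_adjoint ?P \<in> carrier_mat n n" by (simp_all add: mat_adjoint_carrier)
  have fi: "f i < n" if "i < n" for i using f that by (auto simp: bij_betw_def)
  have inj: "f i = f j \<longleftrightarrow> i = j" if "i < n" "j < n" for i j
    using f that by (auto simp: bij_betw_def inj_on_def)
  have "mat_adjoint ?P * ?P = 1\<^sub>m n"
  proof (rule eq_matI)
    fix i j assume "i < dim_row (1\<^sub>m n)" "j < dim_col (1\<^sub>m n)"
    hence ij: "i < n" "j < n" by auto
    have "(mat_adjoint ?P * ?P) $$ (i, j) = (\<Sum>k<n. cnj (?P $$ (k, i)) * ?P $$ (k, j))"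
      using ij P by (simp add: scalar_prod_def atLeast0LessThan index_mat_adjoint[of _ n n])
    also have "\<dots> = (\<Sum>k<n. if k = f i then (if f i = f j then 1 else 0) else 0)"
      using ij by (intro sum.cong) (auto simp: perm_mat_def)
    also have "\<dots> = (if i = j then 1 else 0)" using ij fi inj by (simp add: sum.delta)
    finally show "(mat_adjoint ?P * ?P) $$ (i, j) = 1\<^sub>m n $$ (i, j)" using ij by simp
  qed (use P in auto)
  thus U: "unitary_mat n ?P" by (intro unitary_matI) auto
  have "?P * real_diag n (d \<circ> f) = real_diag n d * ?P"
  proof (rule eq_matI)
    fix i j assume "i < dim_row (real_diag n d * ?P)" "j < dim_col (real_diag n d * ?P)"
    hence ij: "i < n" "j < n" by (auto simp: perm_mat_def)
    thus "(?P * real_diag n (d \<circ> f)) $$ (i, j) = (real_diag n d * ?P) $$ (i, j)"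
      using P by (simp add: real_diag_def mat_diag_mult_left[of _ n n] mat_diag_mult_right[of _ n n]) (simp add: perm_mat_def)
  qed (auto simp: perm_mat_def)
  hence "?P * real_diag n (d \<circ> f) * mat_adjoint ?P = real_diag n d * (?P * mat_adjoint ?P)"
    using P by (simp add: assoc_mult_mat[of _ n n _ n _ n])
  thus "?P * real_diag n (d \<circ> f) * mat_adjoint ?P = real_diag n d"
    using unitary_matD[OF U] by simp
qed

lemma exists_decreasing_rearrangement:
  fixes d :: "nat \<Rightarrow> real"
  shows "\<exists>f. bij_betw f {..<n} {..<n} \<and> (\<forall>i j. i \<le> j \<longrightarrow> j < n \<longrightarrow> d (f j) \<le> d (f i))"
proof -
  define l where "l = sort_key (\<lambda>i. - d i) [0..<n]"
  have l: "length l = n" "distinct l" "set l = {..<n}" by (auto simp: l_def)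
  have "sorted (map (\<lambda>i. - d i) l)" by (simp add: l_def)
  hence "d (l ! j) \<le> d (l ! i)" if "i \<le> j" "j < n" for i j
    using that l(1) sorted_nth_mono[of "map (\<lambda>i. - d i) l" i j] by simp
  moreover have "bij_betw ((!) l) {..<n} {..<n}" by (rule bij_betw_nth[OF l(2)]) (simp_all add: l(1,3))
  ultimately show ?thesis by blast
qed

corollary hermitian_sorted_diagonalization:
  assumes "X \<in> carrier_mat n n" "mat_adjoint X = X"
  obtains U d where "unitary_mat n U" "X = unitary_diag n U d"
    "\<And>i j. i \<le> j \<Longrightarrow> j < n \<Longrightarrow> d j \<le> d i"
proof -
  obtain U d where U: "unitary_mat n U" "X = unitary_diag n U d"
    using hermitian_diagonalization[OF assms] by blast
  obtain f where f: "bij_betw f {..<n} {..<n}" "\<And>i j. i \<le> j \<Longrightarrow> j < n \<Longrightarrow> d (f j) \<le> d (f i)"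
    using exists_decreasing_rearrangement[of n d] by blast
  note P = unitary_perm_mat[OF f(1)]
  note c = unitary_matD[OF U(1)] unitary_matD[OF P(1)]
  have "X = U * (perm_mat n f * real_diag n (d \<circ> f) * mat_adjoint (perm_mat n f)) * mat_adjoint U"
    unfolding P(2) by (rule U(2))
  hence "X = (U * perm_mat n f) * real_diag n (d \<circ> f) * mat_adjoint (U * perm_mat n f)"
    using c(1,2,5,6) by (simp add: mat_adjoint_mult[of _ n] assoc_mult_mat[of _ n n _ n _ n] mult_carrier_mat[of _ n n _ n])
  with unitary_mat_mult[OF U(1) P(1)] show thesis using f(2) by (intro that) auto
qed

text \<open>The \<open>i\<close>-th eigenvalue is the value of the quadratic form at the \<open>i\<close>-th column of \<open>U\<close>.\<close>
lemma psd_sorted_diagonalization: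
  assumes X: "psd_mat n X"
  obtains U d where "unitary_mat n U" "X = unitary_diag n U d"
    "\<And>i j. i \<le> j \<Longrightarrow> j < n \<Longrightarrow> d j \<le> d i" "\<And>i. i < n \<Longrightarrow> 0 \<le> d i"
proof -
  have Xc: "X \<in> carrier_mat n n" "mat_adjoint X = X" using X by (auto simp: psd_mat_def)
  obtain U d where U: "unitary_mat n U" "X = unitary_diag n U d"
    "\<And>i j. i \<le> j \<Longrightarrow> j < n \<Longrightarrow> d j \<le> d i"
    using hermitian_sorted_diagonalization[OF Xc] by blast
  note c = unitary_matD[OF U(1)]
  have "0 \<le> d i" if i: "i < n" for i
  proof -
    have v: "col U i \<in> carrier_vec n" using c by auto
    have "mat_adjoint U * X * U = real_diag n d"
      by (rule unitary_conj_iff[OF U(1) Xc(1) real_diag_carrier, THEN iffD1, OF U(2)])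
    hence "complex_of_real (d i) = (mat_adjoint U * (X * U)) $$ (i, i)"
      using i c Xc by (simp add: assoc_mult_mat[of _ n n _ n _ n])
    also have "\<dots> = (X *\<^sub>v col U i) \<bullet>c col U i"
      using i c(1,2) Xc by (simp add: scalar_prod_def index_mat_adjoint[of _ n n] mult.commute)
    finally have "0 \<le> complex_of_real (d i)" using X v by (simp add: psd_mat_def)
    thus ?thesis by (simp add: less_eq_complex_def)
  qed
  thus thesis using that U by blast
qed

section \<open>Horn's inequality for the singular values of a product\<close>

lemma unitary_diag_carrier: "unitary_mat n U \<Longrightarrow> unitary_diag n U d \<in> carrier_mat n n"
  by (intro mult_carrier_mat[of _ n n _ n]) (simp_all add: unitary_matD)

lemma mat_adjoint_unitary_diag:
  assumes U: "unitary_mat n U"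
  shows "mat_adjoint (unitary_diag n U d) = unitary_diag n U d"
  using unitary_matD(1,2)[OF U]
  by (simp add: mat_adjoint_mult[of _ n] assoc_mult_mat[of _ n n _ n _ n] mult_carrier_mat[of _ n n _ n])

lemma unitary_diag_mult:
  assumes U: "unitary_mat n U"
  shows "unitary_diag n U d * unitary_diag n U e = unitary_diag n U (\<lambda>i. d i * e i)"
proof -
  note c = unitary_matD[OF U]
  have "unitary_diag n U d * unitary_diag n U e = U * (real_diag n d * ((mat_adjoint U * U) * real_diag n e)) * mat_adjoint U"
    using c(1,2) by (simp add: assoc_mult_mat[of _ n n _ n _ n] mult_carrier_mat[of _ n n _ n])
  thus ?thesis using c by (simp add: real_diag_mult left_mult_one_mat[of _ n n])
qed

lemma det_unitary_diag:
  assumes U: "unitary_mat n U"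
  shows "det (unitary_diag n U d) = complex_of_real (\<Prod>i<n. d i)"
proof -
  note c = unitary_matD[OF U]
  have "det (unitary_diag n U d) = det (U * mat_adjoint U) * det (real_diag n d)"
    using c(1,2) by (simp add: det_mult[of _ n] mult_carrier_mat[of _ n n _ n])
  thus ?thesis using c(3) by (simp add: det_real_diag)
qed

text \<open>
  For Hermitian \<open>D\<close> and \<open>E\<close>, \<open>D E\<^sup>2 D\<close> is the Gram matrix of \<open>E D\<close>; in the eigenbasis \<open>W\<close> it becomes
  diagonal, so that \<open>sqnorm_gram_diag\<close> applies to \<open>E D W\<close>.
\<close>
lemma gram_product:
  assumes D: "D \<in> carrier_mat n n" "mat_adjoint D = D" and E: "E \<in> carrier_mat n n" "mat_adjoint E = E"
    and W: "unitary_mat n W" and eq: "D * (E * E) * D = unitary_diag n W x"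
  shows "mat_adjoint (E * D * W) * (E * D * W) = real_diag n x"
proof -
  note c = unitary_matD[OF W]
  have "mat_adjoint (E * D * W) * (E * D * W) = mat_adjoint W * (D * (E * E) * D) * W"
    using c(1,2) D E
    by (simp add: mat_adjoint_mult[of _ n] assoc_mult_mat[of _ n n _ n _ n] mult_carrier_mat[of _ n n _ n])
  also have "\<dots> = real_diag n x"
    by (rule unitary_conj_iff[OF W _ real_diag_carrier, THEN iffD1, OF _ eq]) (use D E in \<open>simp add: mult_carrier_mat[of _ n n _ n]\<close>)
  finally show ?thesis .
qed

text \<open>
  Evaluate \<open>\<parallel>E D w\<parallel>\<^sup>2 \<ge> t\<^sup>2 \<parallel>D w\<parallel>\<^sup>2 \<ge> t\<^sup>2 s\<^sup>2 \<parallel>w\<parallel>\<^sup>2\<close> at a unit eigenvector \<open>w\<close>. With \<open>s = t = 0\<close> this says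
  that the eigenvalues are nonnegative.
\<close>
lemma gram_eigenvalue_lower:
  assumes U: "unitary_mat n U" and V: "unitary_mat n V" and W: "unitary_mat n W"
    and eq: "unitary_diag n U d * (unitary_diag n V e * unitary_diag n V e) * unitary_diag n U d = unitary_diag n W x"
    and s: "0 \<le> s" "\<And>i. i < n \<Longrightarrow> s \<le> d i" and t: "0 \<le> t" "\<And>i. i < n \<Longrightarrow> t \<le> e i" and i: "i < n"
  shows "(s * t)\<^sup>2 \<le> x i"
proof -
  note c = unitary_diag_carrier[OF U, of d] unitary_diag_carrier[OF V, of e] unitary_matD[OF W]
  define z :: "complex vec" where "z = unit_vec n i"
  have z: "z \<in> carrier_vec n" by (simp add: z_def)
  have delta: "(\<Sum>j<n. a j * (cmod (z $ j))\<^sup>2) = a i" for a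
  proof -
    have "(\<Sum>j<n. a j * (cmod (z $ j))\<^sup>2) = (\<Sum>j<n. if i = j then a j else 0)"
      using i by (intro sum.cong) (auto simp: z_def)
    thus ?thesis using i by simp
  qed
  let ?w = "W *\<^sub>v z"
  note w = mult_mat_vec_carrier[OF c(3) z] mult_mat_vec_carrier[OF c(1) mult_mat_vec_carrier[OF c(3) z]]
  have "(s * t)\<^sup>2 = t\<^sup>2 * (s\<^sup>2 * sqnorm ?w)"
    using delta[of "\<lambda>_. 1"] sqnorm_unitary[OF W z] sqnorm_eq_sum[OF z] by (simp add: power_mult_distrib)
  also have "\<dots> \<le> t\<^sup>2 * sqnorm (unitary_diag n U d *\<^sub>v ?w)"
    unfolding sqnorm_unitary_diag_const[OF U w(1), symmetric]
    by (intro mult_left_mono sqnorm_unitary_diag_mono[OF U w(1)]) (use s in auto)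
  also have "\<dots> \<le> sqnorm (unitary_diag n V e *\<^sub>v (unitary_diag n U d *\<^sub>v ?w))"
    unfolding sqnorm_unitary_diag_const[OF V w(2), symmetric]
    by (intro sqnorm_unitary_diag_mono[OF V w(2)]) (use t in auto)
  also have "unitary_diag n V e *\<^sub>v (unitary_diag n U d *\<^sub>v ?w) = (unitary_diag n V e * unitary_diag n U d * W) *\<^sub>v z"
    using assoc_mult_mat_vec[OF mult_carrier_mat[OF c(2,1)] c(3) z] assoc_mult_mat_vec[OF c(2,1) w(1)] by simp
  also have "sqnorm \<dots> = x i"
    unfolding delta[of x, symmetric]
    by (rule sqnorm_gram_diag[OF _ gram_product[OF c(1) mat_adjoint_unitary_diag[OF U] c(2) mat_adjoint_unitary_diag[OF V] W eq] z])
       (use c in \<open>simp add: mult_carrier_mat[of _ n n _ n]\<close>)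
  finally show ?thesis .
qed

text \<open>
  Enlarging \<open>E\<close> in its own eigenbasis enlarges \<open>\<parallel>E D w\<parallel>\<close> for each \<open>w\<close>. Enlarging \<open>D\<close> does not: instead
  \<open>D = D' C\<close> with the contraction \<open>C = D'\<^sup>-\<^sup>1 D\<close>, and \<open>minmax_le\<close> tolerates contractions. This avoids
  passing from \<open>E D\<close> to \<open>D E\<close> and comparing the spectra of the two products.
\<close>
lemma gram_eigenvalue_mono:
  assumes U: "unitary_mat n U" and V: "unitary_mat n V" and W: "unitary_mat n W" and W': "unitary_mat n W'"
    and eq: "unitary_diag n U d * (unitary_diag n V e * unitary_diag n V e) * unitary_diag n U d = unitary_diag n W x"
    and eq': "unitary_diag n U d' * (unitary_diag n V e' * unitary_diag n V e') * unitary_diag n U d' = unitary_diag n W' x'"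
    and d: "\<And>i. i < n \<Longrightarrow> 0 \<le> d i \<and> d i \<le> d' i \<and> 0 < d' i"
    and e: "\<And>i. i < n \<Longrightarrow> 0 \<le> e i \<and> e i \<le> e' i"
    and x: "\<And>i j. i \<le> j \<Longrightarrow> j < n \<Longrightarrow> x j \<le> x i" and x': "\<And>i j. i \<le> j \<Longrightarrow> j < n \<Longrightarrow> x' j \<le> x' i"
    and k: "k < n"
  shows "x k \<le> x' k"
proof -
  define C where "C = unitary_diag n U (\<lambda>i. d i / d' i)"
  have C: "C \<in> carrier_mat n n" unfolding C_def by (rule unitary_diag_carrier[OF U])
  have "d' i * (d i / d' i) = d i" if "i < n" for i using d[OF that] by simp
  hence "real_diag n (\<lambda>i. d' i * (d i / d' i)) = real_diag n d" by (rule real_diag_cong)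
  hence D'C: "unitary_diag n U d' * C = unitary_diag n U d"
    unfolding C_def unitary_diag_mult[OF U] by (simp only:)
  note c = unitary_diag_carrier[OF U, of d] unitary_diag_carrier[OF U, of d'] unitary_diag_carrier[OF V, of e] unitary_diag_carrier[OF V, of e'] C
    unitary_matD(1,2)[OF W] unitary_matD(1,2)[OF W']
  \<comment> \<open>The contraction \<open>C\<close>, written from the eigenbasis \<open>W\<close> to the eigenbasis \<open>W'\<close>.\<close>
  define G where "G = mat_adjoint W' * (C * W)"
  have CW: "C * W \<in> carrier_mat n n" using c by simp
  have G: "G \<in> carrier_mat n n" using c by (simp add: G_def)
  define K K' where "K = unitary_diag n V e * unitary_diag n U d * W" and "K' = unitary_diag n V e' * unitary_diag n U d' * W'"
  have K: "K \<in> carrier_mat n n" "K' \<in> carrier_mat n n" using c by (simp_all add: K_def K'_def mult_carrier_mat[of _ n n _ n])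
  have gram: "mat_adjoint K * K = real_diag n x" "mat_adjoint K' * K' = real_diag n x'"
    unfolding K_def K'_def
    using gram_product[OF c(1) mat_adjoint_unitary_diag[OF U] c(3) mat_adjoint_unitary_diag[OF V] W eq]
      gram_product[OF c(2) mat_adjoint_unitary_diag[OF U] c(4) mat_adjoint_unitary_diag[OF V] W' eq'] by auto
  have K'G: "K' * G = unitary_diag n V e' * unitary_diag n U d * W"
  proof -
    define D' E' where "D' = unitary_diag n U d'" and "E' = unitary_diag n V e'"
    have c': "D' \<in> carrier_mat n n" "E' \<in> carrier_mat n n" using c by (simp_all add: D'_def E'_def)
    have "K' * G = E' * (D' * ((W' * mat_adjoint W') * (C * W)))"
      unfolding K'_def G_def D'_def[symmetric] E'_def[symmetric] using c(5-9) c'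
      by (simp add: assoc_mult_mat[of _ n n _ n _ n] mult_carrier_mat[of _ n n _ n])
    also have "\<dots> = E' * (D' * C) * W"
      using unitary_matD(3)[OF W'] c(5-9) c'
      by (simp add: assoc_mult_mat[of _ n n _ n _ n] mult_carrier_mat[of _ n n _ n] left_mult_one_mat[of _ n n])
    finally show ?thesis by (simp only: D'_def E'_def D'C)
  qed
  have x'0: "0 \<le> x' k"
    using gram_eigenvalue_lower[OF U V W' eq', of 0 0 k] d e k by force
  show ?thesis
  proof (rule minmax_le[where x = x and y = x', OF G k x x' x'0])
    fix z :: "complex vec" assume z: "z \<in> carrier_vec n"
    note Wz = mult_mat_vec_carrier[OF c(6) z] mult_mat_vec_carrier[OF C mult_mat_vec_carrier[OF c(6) z]]
    have "sqnorm (G *\<^sub>v z) = sqnorm (mat_adjoint W' *\<^sub>v (C *\<^sub>v (W *\<^sub>v z)))"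
      unfolding G_def using assoc_mult_mat_vec[OF c(9) CW z] assoc_mult_mat_vec[OF C c(6) z] by simp
    also have "\<dots> = sqnorm (C *\<^sub>v (W *\<^sub>v z))" by (rule sqnorm_unitary[OF unitary_mat_adjoint[OF W'] Wz(2)])
    also have "\<dots> \<le> sqnorm (unitary_diag n U (\<lambda>_. 1) *\<^sub>v (W *\<^sub>v z))"
      unfolding C_def
    proof (rule sqnorm_unitary_diag_mono[OF U Wz(1)])
      fix i assume "i < n"
      from d[OF this] show "0 \<le> d i / d' i \<and> d i / d' i \<le> 1" by simp
    qed
    also have "\<dots> = sqnorm z" using sqnorm_unitary_diag_const[OF U Wz(1), of 1] sqnorm_unitary[OF W z] by simp
    finally show "sqnorm (G *\<^sub>v z) \<le> sqnorm z" .
    note DWz = mult_mat_vec_carrier[OF c(1) Wz(1)]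
    have EDWz: "(unitary_diag n V f * unitary_diag n U d * W) *\<^sub>v z = unitary_diag n V f *\<^sub>v (unitary_diag n U d *\<^sub>v (W *\<^sub>v z))" for f
      using assoc_mult_mat_vec[OF mult_carrier_mat[OF unitary_diag_carrier[OF V, of f] c(1)] c(6) z]
        assoc_mult_mat_vec[OF unitary_diag_carrier[OF V, of f] c(1) Wz(1)] by simp
    have "(\<Sum>i<n. x i * (cmod (z $ i))\<^sup>2) = sqnorm (K *\<^sub>v z)"
      by (rule sqnorm_gram_diag[OF K(1) gram(1) z, symmetric])
    also have "\<dots> \<le> sqnorm (K' * G *\<^sub>v z)"
      unfolding K_def K'G EDWz using e by (intro sqnorm_unitary_diag_mono[OF V DWz]) auto
    also have "K' * G *\<^sub>v z = K' *\<^sub>v (G *\<^sub>v z)" by (rule assoc_mult_mat_vec[OF K(2) G z])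
    also have "sqnorm \<dots> = (\<Sum>i<n. x' i * (cmod ((G *\<^sub>v z) $ i))\<^sup>2)"
      by (rule sqnorm_gram_diag[OF K(2) gram(2) mult_mat_vec_carrier[OF G z]])
    finally show "(\<Sum>i<n. x i * (cmod (z $ i))\<^sup>2) \<le> (\<Sum>i<n. x' i * (cmod ((G *\<^sub>v z) $ i))\<^sup>2)" .
  qed auto
qed

text \<open>
  The spectra are flattened after index \<open>k\<close> and shifted by \<open>\<epsilon>\<close>. The determinant gives equality of the
  full products for the flattened matrices, and the factors after index \<open>k\<close> cancel because each of
  the \<open>x' i\<close> is at least \<open>r\<close>, while the corresponding factor on the other side equals \<open>r\<close>.
\<close>
lemma horn_log_majorization_perturbed:
  assumes U: "unitary_mat n U" and V: "unitary_mat n V" and W: "unitary_mat n W"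
    and eq: "unitary_diag n U d * (unitary_diag n V e * unitary_diag n V e) * unitary_diag n U d = unitary_diag n W x"
    and d: "\<And>i j. i \<le> j \<Longrightarrow> j < n \<Longrightarrow> d j \<le> d i" "\<And>i. i < n \<Longrightarrow> 0 \<le> d i"
    and e: "\<And>i j. i \<le> j \<Longrightarrow> j < n \<Longrightarrow> e j \<le> e i" "\<And>i. i < n \<Longrightarrow> 0 \<le> e i"
    and x: "\<And>i j. i \<le> j \<Longrightarrow> j < n \<Longrightarrow> x j \<le> x i"
    and k: "k < n" and \<epsilon>: "0 < \<epsilon>"
  shows "(\<Prod>i\<le>k. x i) \<le> (\<Prod>i\<le>k. ((d i + \<epsilon>) * (e i + \<epsilon>))\<^sup>2)"
proof -
  define d' e' where "d' i = d (min i k) + \<epsilon>" and "e' i = e (min i k) + \<epsilon>" for i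
  define D E where "D = unitary_diag n U d'" and "E = unitary_diag n V e'"
  have DE: "D \<in> carrier_mat n n" "mat_adjoint D = D" "E \<in> carrier_mat n n" "mat_adjoint E = E"
    unfolding D_def E_def using unitary_diag_carrier mat_adjoint_unitary_diag U V by blast+
  define M where "M = D * (E * E) * D"
  have M: "M \<in> carrier_mat n n" "mat_adjoint M = M"
    using DE by (simp_all add: M_def mat_adjoint_mult[of _ n] assoc_mult_mat[of _ n n _ n _ n] mult_carrier_mat[of _ n n _ n])
  obtain W' x' where W': "unitary_mat n W'" "M = unitary_diag n W' x'" "\<And>i j. i \<le> j \<Longrightarrow> j < n \<Longrightarrow> x' j \<le> x' i"
    using hermitian_sorted_diagonalization[OF M] by blast
  note eq' = W'(2)[unfolded M_def D_def E_def]
  define r where "r = ((d k + \<epsilon>) * (e k + \<epsilon>))\<^sup>2"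
  have r: "r > 0" using d(2)[OF k] e(2)[OF k] \<epsilon> by (simp add: r_def)
  have le: "x i \<le> x' i" if "i < n" for i
  proof (rule gram_eigenvalue_mono[OF U V W W'(1) eq eq' _ _ x W'(3) that])
    fix i assume i: "i < n"
    have "d i \<le> d (min i k)" "e i \<le> e (min i k)" using d(1)[of "min i k" i] e(1)[of "min i k" i] i by auto
    thus "0 \<le> d i \<and> d i \<le> d' i \<and> 0 < d' i" "0 \<le> e i \<and> e i \<le> e' i"
      using d(2)[OF i] e(2)[OF i] \<epsilon> by (auto simp: d'_def e'_def)
  qed
  have lower: "r \<le> x' i" if "i < n" for i
    unfolding r_def
  proof (rule gram_eigenvalue_lower[OF U V W'(1) eq' _ _ _ _ that])
    show "0 \<le> d k + \<epsilon>" "0 \<le> e k + \<epsilon>" using d(2)[OF k] e(2)[OF k] \<epsilon> by auto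
    show "d k + \<epsilon> \<le> d' i" "e k + \<epsilon> \<le> e' i" for i
      using d(1)[of "min i k" k] e(1)[of "min i k" k] k by (auto simp: d'_def e'_def)
  qed
  have "complex_of_real (\<Prod>i<n. x' i) = det (D * (E * E) * D)"
    using det_unitary_diag[OF W'(1), of x'] W'(2) by (simp add: M_def)
  also have "\<dots> = det D * det E * det E * det D"
    using DE by (simp add: det_mult[of _ n] mult_carrier_mat[of _ n n _ n])
  also have "\<dots> = complex_of_real (\<Prod>i<n. (d' i * e' i)\<^sup>2)"
    unfolding D_def E_def det_unitary_diag[OF U] det_unitary_diag[OF V]
    by (simp add: power2_eq_square prod.distrib mult_ac)
  finally have det: "(\<Prod>i<n. x' i) = (\<Prod>i<n. (d' i * e' i)\<^sup>2)" by (simp only: of_real_eq_iff)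
  have split: "(\<Prod>i<n. f i) = (\<Prod>i\<le>k. f i) * (\<Prod>i\<in>{k<..<n}. f i)" for f :: "nat \<Rightarrow> real"
  proof -
    have "{..<n} = {..k} \<union> {k<..<n}" using k by auto
    thus ?thesis by (simp add: prod.union_disjoint ivl_disj_int)
  qed
  have x0: "0 \<le> x i" if "i < n" for i
    using gram_eigenvalue_lower[OF U V W eq, of 0 0 i] d(2) e(2) that by simp
  have "(\<Prod>i\<le>k. x i) * r ^ card {k<..<n} \<le> (\<Prod>i\<le>k. x' i) * (\<Prod>i\<in>{k<..<n}. x' i)"
    using le lower r k x0 by (intro mult_mono prod_mono order_trans[OF eq_refl[OF prod_constant[symmetric]]] prod_nonneg) (auto intro: order.trans less_imp_le)
  also have "\<dots> = (\<Prod>i\<le>k. (d' i * e' i)\<^sup>2) * (\<Prod>i\<in>{k<..<n}. (d' i * e' i)\<^sup>2)"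
    using det unfolding split .
  also have "\<dots> = (\<Prod>i\<le>k. ((d i + \<epsilon>) * (e i + \<epsilon>))\<^sup>2) * (\<Prod>i\<in>{k<..<n}. r)"
    by (intro arg_cong2[of _ _ _ _ "(*)"] prod.cong) (auto simp: d'_def e'_def r_def)
  finally show ?thesis using r by simp
qed

theorem horn_log_majorization:
  assumes U: "unitary_mat n U" and V: "unitary_mat n V" and W: "unitary_mat n W"
    and eq: "unitary_diag n U d * (unitary_diag n V e * unitary_diag n V e) * unitary_diag n U d = unitary_diag n W x"
    and d: "\<And>i j. i \<le> j \<Longrightarrow> j < n \<Longrightarrow> d j \<le> d i" "\<And>i. i < n \<Longrightarrow> 0 \<le> d i"
    and e: "\<And>i j. i \<le> j \<Longrightarrow> j < n \<Longrightarrow> e j \<le> e i" "\<And>i. i < n \<Longrightarrow> 0 \<le> e i"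
    and x: "\<And>i j. i \<le> j \<Longrightarrow> j < n \<Longrightarrow> x j \<le> x i"
    and k: "k < n"
  shows "(\<Prod>i\<le>k. x i) \<le> (\<Prod>i\<le>k. (d i * e i)\<^sup>2)"
proof (rule tendsto_lowerbound)
  show "((\<lambda>\<epsilon>. \<Prod>i\<le>k. ((d i + \<epsilon>) * (e i + \<epsilon>))\<^sup>2) \<longlongrightarrow> (\<Prod>i\<le>k. (d i * e i)\<^sup>2)) (at_right 0)"
    by (auto intro!: tendsto_eq_intros)
  show "\<forall>\<^sub>F \<epsilon> in at_right 0. (\<Prod>i\<le>k. x i) \<le> (\<Prod>i\<le>k. ((d i + \<epsilon>) * (e i + \<epsilon>))\<^sup>2)"
    using eventually_at_right_less[of 0]
    by eventually_elim (rule horn_log_majorization_perturbed[OF U V W eq d e x k])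
qed simp

section \<open>From log-majorization to weak majorization\<close>

text \<open>
  Summation by parts: the difference of the two sides is the sum of the nonnegative partial sums of \<open>c\<close>
  weighted by the nonnegative decrements of \<open>l\<close>.
\<close>
lemma abel_sum_lower_bound:
  fixes l c :: "nat \<Rightarrow> real"
  assumes "\<And>i j. i \<le> j \<Longrightarrow> j \<le> m \<Longrightarrow> l j \<le> l i" and "\<And>k. k \<le> m \<Longrightarrow> 0 \<le> (\<Sum>i\<le>k. c i)"
  shows "l m * (\<Sum>i\<le>m. c i) \<le> (\<Sum>i\<le>m. l i * c i)"
  using assms
proof (induction m)
  case (Suc m)
  have "l (Suc m) * (\<Sum>i\<le>m. c i) \<le> l m * (\<Sum>i\<le>m. c i)"
    using Suc.prems(1)[of m "Suc m"] Suc.prems(2)[of m] by (intro mult_right_mono) auto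
  also have "\<dots> \<le> (\<Sum>i\<le>m. l i * c i)" using Suc.prems by (intro Suc.IH) auto
  finally show ?case by (simp add: algebra_simps)
qed simp

text \<open>
  By concavity of the logarithm \<open>y\<^sub>i - x\<^sub>i \<ge> x\<^sub>i (ln y\<^sub>i - ln x\<^sub>i)\<close>. The partial sums of the
  differences of logarithms are nonnegative by hypothesis, and the weights \<open>x\<^sub>i\<close> decrease, so the
  partial sums stay nonnegative after weighting. The induction on \<open>k\<close> only serves to dispose of vanishing
  \<open>x\<^sub>k\<close>, for which there is no logarithm.
\<close>
lemma log_majorization_imp_majorization:
  fixes x y :: "nat \<Rightarrow> real"
  assumes x: "\<And>i j. i \<le> j \<Longrightarrow> j < n \<Longrightarrow> x j \<le> x i" "\<And>i. i < n \<Longrightarrow> 0 \<le> x i"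
    and y: "\<And>i. i < n \<Longrightarrow> 0 \<le> y i"
    and le: "\<And>k. k < n \<Longrightarrow> (\<Prod>i\<le>k. x i) \<le> (\<Prod>i\<le>k. y i)"
    and "k < n"
  shows "(\<Sum>i\<le>k. x i) \<le> (\<Sum>i\<le>k. y i)"
  using \<open>k < n\<close>
proof (induction k)
  case 0
  thus ?case using le[of 0] by simp
next
  case (Suc k)
  show ?case
  proof (cases "x (Suc k) = 0")
    case True
    thus ?thesis using Suc y[of "Suc k"] by simp
  next
    case False
    have xpos: "0 < x i" if "i \<le> Suc k" for i
      using x(1)[OF that Suc.prems] x(2)[OF Suc.prems] False by linarith
    have ypos: "0 < y i" if i: "i \<le> Suc k" for i
    proof -
      have "0 < (\<Prod>j\<le>i. x j)" using xpos i by (intro prod_pos) auto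
      also have "\<dots> \<le> (\<Prod>j\<le>i. y j)" using le[of i] i Suc.prems by simp
      finally have "y i \<noteq> 0" by (metis prod_zero finite_atMost atMost_iff order_refl less_irrefl)
      thus ?thesis using y[of i] i Suc.prems by simp
    qed
    define c where "c i = ln (y i) - ln (x i)" for i
    have c: "0 \<le> (\<Sum>i\<le>j. c i)" if j: "j \<le> Suc k" for j
    proof -
      have "0 < (\<Prod>i\<le>j. x i)" using xpos j by (intro prod_pos) auto
      hence "ln (\<Prod>i\<le>j. x i) \<le> ln (\<Prod>i\<le>j. y i)"
        using le[of j] j Suc.prems by (intro ln_mono) auto
      moreover have "ln (\<Prod>i\<le>j. x i) = (\<Sum>i\<le>j. ln (x i))" "ln (\<Prod>i\<le>j. y i) = (\<Sum>i\<le>j. ln (y i))"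
        using xpos ypos j by (auto intro!: ln_prod less_imp_neq[symmetric])
      ultimately show ?thesis by (simp add: c_def sum_subtractf)
    qed
    have "0 \<le> x (Suc k) * (\<Sum>i\<le>Suc k. c i)"
      by (rule mult_nonneg_nonneg[OF less_imp_le[OF xpos[OF order_refl]] c[OF order_refl]])
    also have "\<dots> \<le> (\<Sum>i\<le>Suc k. x i * c i)"
    proof (rule abel_sum_lower_bound)
      show "x j \<le> x i" if "i \<le> j" "j \<le> Suc k" for i j using x(1)[of i j] that Suc.prems by simp
    qed (rule c)
    also have "\<dots> \<le> (\<Sum>i\<le>Suc k. y i - x i)"
    proof (rule sum_mono)
      fix i assume "i \<in> {..Suc k}"
      hence i: "0 < x i" "0 < y i" using xpos ypos by auto
      have "c i \<le> y i / x i - 1" using ln_le_minus_one[of "y i / x i"] i by (simp add: c_def ln_div)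
      hence "x i * c i \<le> x i * (y i / x i - 1)" using i by (intro mult_left_mono) auto
      moreover have "x i * (y i / x i - 1) = y i - x i" using i by (simp add: right_diff_distrib)
      ultimately show "x i * c i \<le> y i - x i" by simp
    qed
    finally show ?thesis by (simp add: sum_subtractf)
  qed
qed

section \<open>Unitarily invariant norms of diagonal matrices\<close>

text \<open>
  On diagonal matrices a unitarily invariant norm is a symmetric gauge function: convex, invariant under
  permutations and under sign changes of the entries.
\<close>

context
  fixes n N assumes N: "unitarily_invariant_norm n N"
begin

lemma norm_unitary_diag: "unitary_mat n U \<Longrightarrow> N (unitary_diag n U d) = N (real_diag n d)"
  using N unitary_mat_adjoint[of n U] by (simp add: unitarily_invariant_norm_def)

lemma norm_diag_nonneg: "0 \<le> N (real_diag n d)"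
  using N by (simp add: unitarily_invariant_norm_def matrix_norm_def)

lemma norm_diag_convex:
  assumes "0 \<le> a" "0 \<le> b" "\<And>i. i < n \<Longrightarrow> w i = a * u i + b * v i"
  shows "N (real_diag n w) \<le> a * N (real_diag n u) + b * N (real_diag n v)"
proof -
  have "real_diag n w = complex_of_real a \<cdot>\<^sub>m real_diag n u + complex_of_real b \<cdot>\<^sub>m real_diag n v"
    using assms(3) by (intro eq_matI) auto
  moreover have "N (X + Y) \<le> N X + N Y" if "X \<in> carrier_mat n n" "Y \<in> carrier_mat n n" for X Y
    using N that by (simp add: unitarily_invariant_norm_def matrix_norm_def)
  hence "N (complex_of_real a \<cdot>\<^sub>m real_diag n u + complex_of_real b \<cdot>\<^sub>m real_diag n v)
      \<le> N (complex_of_real a \<cdot>\<^sub>m real_diag n u) + N (complex_of_real b \<cdot>\<^sub>m real_diag n v)"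
    by simp
  moreover have "N (complex_of_real a \<cdot>\<^sub>m real_diag n u) = a * N (real_diag n u)"
    "N (complex_of_real b \<cdot>\<^sub>m real_diag n v) = b * N (real_diag n v)"
    using N assms(1,2) by (simp_all add: unitarily_invariant_norm_def matrix_norm_def)
  ultimately show ?thesis by simp
qed

lemma norm_diag_permute:
  assumes f: "bij_betw f {..<n} {..<n}"
  shows "N (real_diag n (d \<circ> f)) = N (real_diag n d)"
  using norm_unitary_diag[OF unitary_perm_mat(1)[OF f], of "d \<circ> f"] unfolding unitary_perm_mat(2)[OF f] by simp

lemma norm_diag_sign:
  assumes "\<And>i. i < n \<Longrightarrow> \<bar>u i\<bar> = \<bar>v i\<bar>"
  shows "N (real_diag n u) = N (real_diag n v)"
proof -
  define s where "s i = (if u i = v i then 1 else - 1 :: real)" for i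
  have s: "s i * v i = u i" if "i < n" for i using assms[OF that] by (auto simp: s_def abs_eq_iff)
  have ss: "s i * s i = 1" for i by (simp add: s_def)
  have "unitary_mat n (real_diag n s)"
    by (intro unitary_matI) (simp_all add: real_diag_mult ss real_diag_one)
  hence "N (real_diag n s * real_diag n v * 1\<^sub>m n) = N (real_diag n v)"
    using N unitary_mat_one[of n] by (simp add: unitarily_invariant_norm_def del: right_mult_one_mat')
  moreover have "real_diag n s * real_diag n v * 1\<^sub>m n = real_diag n u"
    using s real_diag_cong[of n "\<lambda>i. s i * v i" u] by (simp add: real_diag_mult right_mult_one_mat[of _ n n])
  ultimately show ?thesis by simp
qed

text \<open>An entry in \<open>[0, v k]\<close> is a convex combination of \<open>v k\<close> and \<open>- v k\<close>.\<close>
lemma norm_diag_shrink_entry: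
  assumes "0 \<le> u" "u \<le> v k"
  shows "N (real_diag n (v(k := u))) \<le> N (real_diag n v)"
proof (cases "v k = 0")
  case True
  hence "v(k := u) = v" using assms by auto
  thus ?thesis by simp
next
  case False
  define t where "t = u / v k"
  have t: "0 \<le> t" "t \<le> 1" "u = t * v k" using assms False by (auto simp: t_def divide_le_eq_1)
  have "N (real_diag n (v(k := u)))
      \<le> (1 + t) / 2 * N (real_diag n v) + (1 - t) / 2 * N (real_diag n (v(k := - v k)))"
    using t by (intro norm_diag_convex) (auto simp: field_simps)
  also have "N (real_diag n (v(k := - v k))) = N (real_diag n v)"
    by (rule norm_diag_sign) auto
  also have "(1 + t) / 2 * N (real_diag n v) + (1 - t) / 2 * N (real_diag n v) = N (real_diag n v)"
    by (simp add: field_simps)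
  finally show ?thesis .
qed

text \<open>The entries are replaced one after the other.\<close>
lemma norm_diag_mono:
  assumes uv: "\<And>i. i < n \<Longrightarrow> 0 \<le> u i \<and> u i \<le> v i"
  shows "N (real_diag n u) \<le> N (real_diag n v)"
proof -
  have "N (real_diag n (\<lambda>i. if i < m then u i else v i)) \<le> N (real_diag n v)" if "m \<le> n" for m
    using that
  proof (induction m)
    case (Suc m)
    have "(\<lambda>i. if i < Suc m then u i else v i) = (\<lambda>i. if i < m then u i else v i)(m := u m)"
      by (auto simp: less_Suc_eq)
    moreover have "N (real_diag n ((\<lambda>i. if i < m then u i else v i)(m := u m)))
        \<le> N (real_diag n (\<lambda>i. if i < m then u i else v i))"
      using uv[of m] Suc.prems by (intro norm_diag_shrink_entry) auto
    ultimately show ?case using Suc by simp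
  qed simp
  from this[of n] show ?thesis
    using real_diag_cong[of n "\<lambda>i. if i < n then u i else v i" u] by simp
qed

text \<open>
  A Robin Hood transfer from a larger to a smaller entry that does not go beyond swapping them yields a
  convex combination of \<open>v\<close> and its transposition.
\<close>
lemma norm_diag_transfer:
  assumes ij: "i < n" "j < n" "i \<noteq> j" and \<delta>: "0 \<le> \<delta>" "\<delta> \<le> v i - v j"
  shows "N (real_diag n (v(i := v i - \<delta>, j := v j + \<delta>))) \<le> N (real_diag n v)"
proof (cases "v i = v j")
  case True
  hence "v(i := v i - \<delta>, j := v j + \<delta>) = v" using \<delta> by auto
  thus ?thesis by simp
next
  case False
  define t where "t = \<delta> / (v i - v j)"
  have pos: "v i - v j > 0" using False \<delta> by linarith
  have t: "0 \<le> t" "t \<le> 1" "t * (v i - v j) = \<delta>" using pos \<delta> by (auto simp: t_def divide_le_eq_1)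
  define f where "f = Transposition.transpose i j"
  have f: "bij_betw f {..<n} {..<n}"
    unfolding f_def using ij by (intro bij_betw_byWitness[of _ f]) (auto simp: f_def Transposition.transpose_def)
  have "N (real_diag n (v(i := v i - \<delta>, j := v j + \<delta>)))
      \<le> (1 - t) * N (real_diag n v) + t * N (real_diag n (v \<circ> f))"
    using t ij(3) by (intro norm_diag_convex) (auto simp: f_def Transposition.transpose_def algebra_simps)
  thus ?thesis unfolding norm_diag_permute[OF f] by (simp add: algebra_simps)
qed

text \<open>
  Weak majorization is turned into domination of entries by transfers. If \<open>j\<close> is the first index with
  \<open>x j > y j\<close>, the partial sums force a surplus \<open>x i < y i\<close> at some \<open>i < j\<close>, and
  \<open>y j < x j \<le> x i < y i\<close> permits a transfer from \<open>i\<close> to \<open>j\<close>. Moving as much as possible makes one more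
  entry of \<open>y\<close> agree with \<open>x\<close>, so the process ends. A transfer may destroy the order of \<open>y\<close>, hence the
  induction ranges over arbitrary \<open>y\<close>.
\<close>
theorem ky_fan_dominance:
  assumes x: "\<And>i j. i \<le> j \<Longrightarrow> j < n \<Longrightarrow> x j \<le> x i" "\<And>i. i < n \<Longrightarrow> 0 \<le> x i"
  shows "(\<And>i. i < n \<Longrightarrow> 0 \<le> y i) \<Longrightarrow> (\<And>k. k < n \<Longrightarrow> (\<Sum>i\<le>k. x i) \<le> (\<Sum>i\<le>k. y i)) \<Longrightarrow>
    N (real_diag n x) \<le> N (real_diag n y)"
proof (induction "card {i. i < n \<and> x i \<noteq> y i}" arbitrary: y rule: less_induct)
  case less
  show ?case
  proof (cases "\<forall>i<n. x i \<le> y i")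
    case True
    thus ?thesis using x(2) by (intro norm_diag_mono) auto
  next
    case False
    define j where "j = (LEAST j. j < n \<and> x j > y j)"
    have j: "j < n" "x j > y j"
      using False LeastI_ex[of "\<lambda>j. j < n \<and> x j > y j"] by (auto simp: j_def not_le)
    have before: "x l \<le> y l" if "l < j" for l
      using not_less_Least[of l "\<lambda>j. j < n \<and> x j > y j"] that j(1) by (auto simp: j_def)
    have "\<exists>i<j. x i < y i"
    proof (rule ccontr)
      assume "\<not> (\<exists>i<j. x i < y i)"
      hence "(\<Sum>l<j. x l) = (\<Sum>l<j. y l)" using before by (intro sum.cong refl) (metis lessThan_iff order_le_less)
      hence "(\<Sum>l\<le>j. y l) < (\<Sum>l\<le>j. x l)" using j by (simp add: lessThan_Suc_atMost[symmetric])
      thus False using less.prems(2)[OF j(1)] by simp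
    qed
    then obtain i where i: "i < j" "x i < y i" by blast
    define \<delta> where "\<delta> = min (y i - x i) (x j - y j)"
    have \<delta>: "0 < \<delta>" "\<delta> \<le> y i - x i" "\<delta> \<le> x j - y j" using i j by (auto simp: \<delta>_def)
    define z where "z = y(i := y i - \<delta>, j := y j + \<delta>)"
    have "N (real_diag n x) \<le> N (real_diag n z)"
    proof (rule less.hyps)
      have "{l. l < n \<and> x l \<noteq> z l} \<subset> {l. l < n \<and> x l \<noteq> y l}"
      proof -
        have "{l. l < n \<and> x l \<noteq> z l} \<subseteq> {l. l < n \<and> x l \<noteq> y l}" using i j by (auto simp: z_def)
        moreover have "x i = z i \<or> x j = z j" using i(1) by (auto simp: z_def \<delta>_def min_def)
        ultimately show ?thesis using i j by auto
      qed
      thus "card {l. l < n \<and> x l \<noteq> z l} < card {l. l < n \<and> x l \<noteq> y l}"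
        by (intro psubset_card_mono) auto
      show "0 \<le> z l" if "l < n" for l
        using less.prems(1)[OF that] less.prems(1)[OF j(1)] x(2)[of i] \<delta> i j by (auto simp: z_def)
      show "(\<Sum>l\<le>k. x l) \<le> (\<Sum>l\<le>k. z l)" if k: "k < n" for k
        \<comment> \<open>Only the partial sums between \<open>i\<close> and \<open>j\<close> change, and there \<open>x\<close> is dominated entry by entry.\<close>
      proof (cases "i \<le> k \<and> k < j")
        case True
        have "(\<Sum>l\<le>k. x l) \<le> (\<Sum>l\<le>k. z l)"
        proof (rule sum_mono)
          fix l assume "l \<in> {..k}"
          thus "x l \<le> z l" using before[of l] True \<delta> by (auto simp: z_def)
        qed
        thus ?thesis .
      next
        case False
        have "(\<Sum>l\<le>k. z l) = (\<Sum>l\<le>k. y l + ((if l = j then \<delta> else 0) - (if l = i then \<delta> else 0)))"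
          using i(1) by (intro sum.cong) (auto simp: z_def)
        also have "\<dots> = (\<Sum>l\<le>k. y l)"
          using False i(1) by (auto simp: sum.distrib sum_subtractf)
        finally show ?thesis using less.prems(2)[OF k] by simp
      qed
    qed
    also have "\<dots> \<le> N (real_diag n y)"
      unfolding z_def using i j \<delta> x(1)[of i j] by (intro norm_diag_transfer) auto
    finally show ?thesis .
  qed
qed

text \<open>
  The parameter \<open>t = s / r\<close> minimizes the bound \<open>t r\<^sup>2 / 2 + s\<^sup>2 / (2 t)\<close> from the arithmetic-geometric
  mean inequality. Adding \<open>\<epsilon>\<close> to both norms keeps \<open>t\<close> well-defined and positive when a norm vanishes.
\<close>
lemma norm_diag_geometric_mean:
  assumes a: "\<And>i. i < n \<Longrightarrow> 0 \<le> a i" and b: "\<And>i. i < n \<Longrightarrow> 0 \<le> b i"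
  shows "N (real_diag n (\<lambda>i. sqrt (a i) * sqrt (b i))) \<le> sqrt (N (real_diag n a)) * sqrt (N (real_diag n b))"
proof (rule tendsto_lowerbound)
  let ?\<alpha> = "N (real_diag n a)" and ?\<beta> = "N (real_diag n b)" and ?c = "\<lambda>i. sqrt (a i) * sqrt (b i)"
  show "((\<lambda>\<epsilon>. sqrt (?\<alpha> + \<epsilon>) * sqrt (?\<beta> + \<epsilon>)) \<longlongrightarrow> sqrt ?\<alpha> * sqrt ?\<beta>) (at_right 0)"
    by (auto intro!: tendsto_eq_intros)
  have "N (real_diag n ?c) \<le> sqrt (?\<alpha> + \<epsilon>) * sqrt (?\<beta> + \<epsilon>)" if "0 < \<epsilon>" for \<epsilon>
  proof -
    define r s where "r = sqrt (?\<alpha> + \<epsilon>)" and "s = sqrt (?\<beta> + \<epsilon>)"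
    have rs: "0 < r" "0 < s" "?\<alpha> \<le> r\<^sup>2" "?\<beta> \<le> s\<^sup>2"
      using norm_diag_nonneg[of a] norm_diag_nonneg[of b] that by (auto simp: r_def s_def)
    define t where "t = s / r"
    have t: "0 < t" using rs by (simp add: t_def)
    have "N (real_diag n ?c) \<le> N (real_diag n (\<lambda>i. t / 2 * a i + 1 / (2 * t) * b i))"
    proof (rule norm_diag_mono)
      fix i assume i: "i < n"
      have "0 \<le> (t * sqrt (a i) - sqrt (b i))\<^sup>2" by simp
      also have "\<dots> = t\<^sup>2 * a i + b i - 2 * t * ?c i"
        using a[OF i] b[OF i] by (simp add: power2_diff power_mult_distrib)
      finally have "2 * t * ?c i \<le> t\<^sup>2 * a i + b i" by simp
      hence "?c i \<le> t / 2 * a i + 1 / (2 * t) * b i" using t by (simp add: field_simps power2_eq_square)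
      thus "0 \<le> ?c i \<and> ?c i \<le> t / 2 * a i + 1 / (2 * t) * b i" using a[OF i] b[OF i] by simp
    qed
    also have "\<dots> \<le> t / 2 * ?\<alpha> + 1 / (2 * t) * ?\<beta>" using t by (intro norm_diag_convex) auto
    also have "\<dots> \<le> t / 2 * r\<^sup>2 + 1 / (2 * t) * s\<^sup>2" using t rs by (intro add_mono mult_left_mono) auto
    also have "\<dots> = r * s" using rs by (simp add: t_def field_simps power2_eq_square)
    finally show ?thesis by (simp add: r_def s_def)
  qed
  thus "\<forall>\<^sub>F \<epsilon> in at_right 0. N (real_diag n ?c) \<le> sqrt (?\<alpha> + \<epsilon>) * sqrt (?\<beta> + \<epsilon>)"
    by (intro eventually_mono[OF eventually_at_right_less[of "0::real"]]) blast
qed simp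

end

lemma mat_powr_unitary_diag: "unitary_mat n U \<Longrightarrow> mat_powr (unitary_diag n U d) s = unitary_diag n U (\<lambda>i. d i powr s)"
  unfolding mat_powr_def by (rule fun_calc_eq) auto

section \<open>The norm inequality\<close>

theorem theorem2p2:
  fixes n :: nat and p :: real and A B :: "complex mat" and N :: "complex mat \<Rightarrow> real"
  assumes "p > 0"
    and "psd_mat n A" and "psd_mat n B"
    and "unitarily_invariant_norm n N"
  shows "N (mat_powr (mat_powr A (p/4) * mat_powr B (p/2) * mat_powr A (p/4)) (1/p))
           \<le> sqrt (N A) * sqrt (N B)
       \<and> sqrt (N A) * sqrt (N B) \<le> (N A + N B) / 2"
proof -
  obtain U a where U: "unitary_mat n U" "A = unitary_diag n U a"
    and a: "\<And>i j. i \<le> j \<Longrightarrow> j < n \<Longrightarrow> a j \<le> a i" "\<And>i. i < n \<Longrightarrow> 0 \<le> a i"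
    using psd_sorted_diagonalization[OF assms(2)] by blast
  obtain V b where V: "unitary_mat n V" "B = unitary_diag n V b"
    and b: "\<And>i j. i \<le> j \<Longrightarrow> j < n \<Longrightarrow> b j \<le> b i" "\<And>i. i < n \<Longrightarrow> 0 \<le> b i"
    using psd_sorted_diagonalization[OF assms(3)] by blast
  define d e where "d = (\<lambda>i. a i powr (p/4))" and "e = (\<lambda>i. b i powr (p/4))"
  define D E where "D = unitary_diag n U d" and "E = unitary_diag n V e"
  have DE: "D \<in> carrier_mat n n" "mat_adjoint D = D" "E \<in> carrier_mat n n" "mat_adjoint E = E"
    unfolding D_def E_def using unitary_diag_carrier mat_adjoint_unitary_diag U(1) V(1) by blast+
  have d: "\<And>i j. i \<le> j \<Longrightarrow> j < n \<Longrightarrow> d j \<le> d i" "\<And>i. i < n \<Longrightarrow> 0 \<le> d i"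
    using a assms(1) by (auto simp: d_def intro!: powr_mono2)
  have e: "\<And>i j. i \<le> j \<Longrightarrow> j < n \<Longrightarrow> e j \<le> e i" "\<And>i. i < n \<Longrightarrow> 0 \<le> e i"
    using b assms(1) by (auto simp: e_def intro!: powr_mono2)
  have "mat_powr B (p/2) = E * E"
    unfolding V(2) E_def mat_powr_unitary_diag[OF V(1)] unitary_diag_mult[OF V(1)] by (simp add: e_def flip: powr_add)
  hence X: "mat_powr A (p/4) * mat_powr B (p/2) * mat_powr A (p/4) = D * (E * E) * D"
    by (simp add: U(2) mat_powr_unitary_diag[OF U(1)] D_def d_def)
  have "D * (E * E) * D \<in> carrier_mat n n" "mat_adjoint (D * (E * E) * D) = D * (E * E) * D"
    using DE by (simp_all add: mat_adjoint_mult[of _ n] assoc_mult_mat[of _ n n _ n _ n] mult_carrier_mat[of _ n n _ n])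
  then obtain W x where W: "unitary_mat n W" "D * (E * E) * D = unitary_diag n W x"
    and x1: "\<And>i j. i \<le> j \<Longrightarrow> j < n \<Longrightarrow> x j \<le> x i"
    using hermitian_sorted_diagonalization by blast
  have x2: "0 \<le> x i" if "i < n" for i
    using gram_eigenvalue_lower[OF U(1) V(1) W(1) W(2)[unfolded D_def E_def], of 0 0 i] d(2) e(2) that by simp
  define g where "g i = sqrt (a i) * sqrt (b i)" for i
  have prods: "(\<Prod>i\<le>k. x i powr (1/p)) \<le> (\<Prod>i\<le>k. g i)" if k: "k < n" for k
  proof -
    have "(\<Prod>i\<le>k. x i powr (1/p)) = (\<Prod>i\<le>k. x i) powr (1/p)"
      by (rule prod_powr_distrib[symmetric])
    also have "\<dots> \<le> (\<Prod>i\<le>k. (d i * e i)\<^sup>2) powr (1/p)"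
      using assms(1) x2 k
      by (intro powr_mono2 prod_nonneg horn_log_majorization[OF U(1) V(1) W(1) W(2)[unfolded D_def E_def] d e x1 k]) auto
    also have "\<dots> = (\<Prod>i\<le>k. ((d i * e i)\<^sup>2) powr (1/p))"
      by (rule prod_powr_distrib)
    also have "\<dots> = (\<Prod>i\<le>k. g i)"
    proof (rule prod.cong)
      fix i assume "i \<in> {..k}"
      hence i: "0 \<le> a i" "0 \<le> b i" using a(2) b(2) k by auto
      have "(d i * e i)\<^sup>2 = (a i * b i) powr (p/2)"
        using i by (simp add: d_def e_def powr_mult power2_eq_square mult_ac flip: powr_add)
      thus "((d i * e i)\<^sup>2) powr (1/p) = g i"
        using i assms(1) by (simp add: powr_powr g_def powr_half_sqrt real_sqrt_mult)
    qed simp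
    finally show ?thesis .
  qed
  have "N (mat_powr (D * (E * E) * D) (1/p)) = N (real_diag n (\<lambda>i. x i powr (1/p)))"
    unfolding W(2) mat_powr_unitary_diag[OF W(1)] by (rule norm_unitary_diag[OF assms(4) W(1)])
  also have "\<dots> \<le> N (real_diag n g)"
  proof (rule ky_fan_dominance[OF assms(4)])
    show xp: "x j powr (1/p) \<le> x i powr (1/p)" if "i \<le> j" "j < n" for i j
      using x1[OF that] x2[OF that(2)] assms(1) by (intro powr_mono2) auto
    show g: "0 \<le> g i" if "i < n" for i using a(2) b(2) that by (simp add: g_def)
    show "(\<Sum>i\<le>k. x i powr (1/p)) \<le> (\<Sum>i\<le>k. g i)" if "k < n" for k
      by (rule log_majorization_imp_majorization[OF xp _ g prods that]) auto
  qed auto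
  also have "\<dots> \<le> sqrt (N A) * sqrt (N B)"
    unfolding g_def U(2) V(2) norm_unitary_diag[OF assms(4) U(1)] norm_unitary_diag[OF assms(4) V(1)]
    by (rule norm_diag_geometric_mean[OF assms(4) a(2) b(2)])
  finally have "N (mat_powr (D * (E * E) * D) (1/p)) \<le> sqrt (N A) * sqrt (N B)" .
  moreover have "sqrt (N A) * sqrt (N B) \<le> (N A + N B) / 2"
  proof -
    have "0 \<le> N A" "0 \<le> N B"
      using norm_diag_nonneg[OF assms(4)] norm_unitary_diag[OF assms(4)] U V by simp_all
    thus ?thesis using arith_geo_mean_sqrt[of "N A" "N B"] by (simp add: real_sqrt_mult)
  qed
  ultimately show ?thesis unfolding X by blast
qed

end
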